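(* Let $C$ be a finite irreducible Coxeter group. Then $C$ is the product of three conjugates of at least one of its proper parabolic subgroups if $C$ is of one of the following types: $A_{n}$ ($n\geq 2$), $B_{n}$ ($n\geq 3$), $D_{n}$ ($n\geq 4$), $H_{4}$, $E_{6}$, $E_{7}$, $E_{8}$. Otherwise, for the remaining types $A_{1}$, $B_{2}$, $F_{4}$, $H_{3}$, $I_{2}(m)$ with $m>4$, $C$ is not a product of three conjugates of a proper parabolic subgroup.
   Context: A finite Coxeter group is a finite group $C$ with a presentation $\langle s_{1},\ldots,s_{n}\mid (s_{i}s_{j})^{m_{ij}}=1,\ 1\leq i,j\leq n\rangle$, where the $m_{ij}$ are positive integers with $m_{ij}=m_{ji}$, $m_{ii}=1$, and $m_{ij}\geq 2$ for $i\neq j$; the generators $s_1,\ldots,s_n$ are fixed as part of the data. Its Coxeter graph has vertices $s_1,\ldots,s_n$, with $s_i,s_j$ ($i\ne j$) joined by an edge iff $m_{ij}\geq 3$, the edge being labeled by $m_{ij}$ if $m_{ij}\geq 4$ and unlabeled if $m_{ij}=3$. $C$ is irreducible if its Coxeter graph is connected. The finite irreducible Coxeter groups are classified by type, with Coxeter graphs as follows: $A_n$ ($n\ge1$): a path on $n$ vertices, all edges unlabeled; $B_n$ ($n\geq 2$): a path on $n$ vertices with one end edge labeled $4$, the others unlabeled; $D_n$ ($n\geq 4$): a path on $n-1$ vertices together with one more vertex joined to the second-to-last vertex of the path, all edges unlabeled; $E_n$ ($n=6,7,8$): the tree with one vertex of degree $3$ and three arms having $1$, $2$ and $n-4$ vertices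 respectively (not counting the branch vertex), all edges unlabeled; $F_4$: a path on $4$ vertices with the middle edge labeled $4$; $H_3$, $H_4$: a path on $3$, resp. $4$, vertices with one end edge labeled $5$; $I_2(m)$ ($m\ge 5$): two vertices joined by an edge labeled $m$ (the dihedral group of order $2m$). For $I'\subseteq\{1,\ldots,n\}$, the standard parabolic subgroup is $\langle s_i\mid i\in I'\rangle$; a parabolic subgroup is a conjugate of a standard parabolic subgroup. "Product of three conjugates of $P$" means a setwise product $P_1P_2P_3$ equal to $C$ with each $P_i$ conjugate to $P$ in $C$. *)

theory Defs
  imports "HOL-Algebra.Generated_Groups"
begin

section \<open>Group presentations\<close>

text \<open>
  A letter \<open>(x, True)\<close> stands for the generator \<open>x\<close> and \<open>(x, False)\<close> for its formal inverse.
  The quotient of the words over \<open>X\<close> by \<open>presented_eq X R\<close> is the group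
  \<open>\<langle>X | r = 1 for r \<in> R\<rangle>\<close>: the rule \<open>cancel\<close> alone yields the free group on \<open>X\<close>.
\<close>

type_synonym 'x word = "('x \<times> bool) list"

definition words :: "'x set \<Rightarrow> 'x word set" where
  "words X = lists (X \<times> UNIV)"

inductive presented_eq :: "'x set \<Rightarrow> 'x word set \<Rightarrow> 'x word \<Rightarrow> 'x word \<Rightarrow> bool"
  for X :: "'x set" and R :: "'x word set" where
  refl: "u \<in> words X \<Longrightarrow> presented_eq X R u u"
| sym: "presented_eq X R u v \<Longrightarrow> presented_eq X R v u"
| trans: "presented_eq X R u v \<Longrightarrow> presented_eq X R v w \<Longrightarrow> presented_eq X R u w"
| append: "presented_eq X R u u' \<Longrightarrow> presented_eq X R v v' \<Longrightarrow> presented_eq X R (u @ v) (u' @ v')"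
| cancel: "x \<in> X \<Longrightarrow> presented_eq X R [(x, b), (x, \<not> b)] []"
| relator: "r \<in> R \<Longrightarrow> presented_eq X R r []"

definition word_value :: "('a, 'b) monoid_scheme \<Rightarrow> ('x \<Rightarrow> 'a) \<Rightarrow> 'x word \<Rightarrow> 'a" where
  "word_value G f w =
     foldr (\<lambda>(x, b) g. (if b then f x else inv\<^bsub>G\<^esub> (f x)) \<otimes>\<^bsub>G\<^esub> g) w \<one>\<^bsub>G\<^esub>"

text \<open>
  \<open>G\<close> is presented by the generators \<open>f x\<close>, \<open>x \<in> X\<close>, and the relators \<open>R\<close>: evaluation of words
  is onto, and two words have the same value exactly if they are equal in \<open>\<langle>X | R\<rangle>\<close>.
\<close>

definition has_presentation ::
    "('a, 'b) monoid_scheme \<Rightarrow> 'x set \<Rightarrow> ('x \<Rightarrow> 'a) \<Rightarrow> 'x word set \<Rightarrow> bool" where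
  "has_presentation G X f R \<longleftrightarrow>
     group G \<and> f ` X \<subseteq> carrier G \<and> R \<subseteq> words X \<and>
     generate G (f ` X) = carrier G \<and>
     (\<forall>u\<in>words X. \<forall>v\<in>words X. word_value G f u = word_value G f v \<longleftrightarrow> presented_eq X R u v)"


section \<open>Finite Coxeter groups and their graphs\<close>

definition coxeter_matrix :: "nat \<Rightarrow> (nat \<Rightarrow> nat \<Rightarrow> nat) \<Rightarrow> bool" where
  "coxeter_matrix n m \<longleftrightarrow>
     (\<forall>i\<in>{1..n}. m i i = 1) \<and>
     (\<forall>i\<in>{1..n}. \<forall>j\<in>{1..n}. m i j = m j i \<and> (i \<noteq> j \<longrightarrow> 2 \<le> m i j))"

definition coxeter_relators :: "nat \<Rightarrow> (nat \<Rightarrow> nat \<Rightarrow> nat) \<Rightarrow> nat word set" where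
  "coxeter_relators n m =
     {concat (replicate (m i j) [(i, True), (j, True)]) | i j. i \<in> {1..n} \<and> j \<in> {1..n}}"

definition finite_coxeter_group ::
    "('a, 'b) monoid_scheme \<Rightarrow> nat \<Rightarrow> (nat \<Rightarrow> 'a) \<Rightarrow> (nat \<Rightarrow> nat \<Rightarrow> nat) \<Rightarrow> bool" where
  "finite_coxeter_group C n s m \<longleftrightarrow>
     coxeter_matrix n m \<and> has_presentation C {1..n} s (coxeter_relators n m) \<and>
     finite (carrier C)"

text \<open>
  A labelled graph is given by its set of pairs of an edge and its label; edges drawn without
  a label carry the label \<open>3\<close>.
\<close>

definition coxeter_graph :: "nat \<Rightarrow> (nat \<Rightarrow> nat \<Rightarrow> nat) \<Rightarrow> (nat set \<times> nat) set" where
  "coxeter_graph n m =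
     {({i, j}, m i j) | i j. i \<in> {1..n} \<and> j \<in> {1..n} \<and> i \<noteq> j \<and> 3 \<le> m i j}"

definition graph_connected :: "nat \<Rightarrow> (nat set \<times> nat) set \<Rightarrow> bool" where
  "graph_connected n E \<longleftrightarrow>
     1 \<le> n \<and> (\<forall>i\<in>{1..n}. \<forall>j\<in>{1..n}. (i, j) \<in> {(a, b). \<exists>k. ({a, b}, k) \<in> E}\<^sup>*)"

definition irreducible_coxeter :: "nat \<Rightarrow> (nat \<Rightarrow> nat \<Rightarrow> nat) \<Rightarrow> bool" where
  "irreducible_coxeter n m \<longleftrightarrow> graph_connected n (coxeter_graph n m)"


section \<open>Types\<close>

datatype coxeter_type =
    Type_A nat | Type_B nat | Type_D nat | Type_E nat | Type_F4 | Type_H3 | Type_H4 | Type_I2 nat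

fun type_rank :: "coxeter_type \<Rightarrow> nat" where
  "type_rank (Type_A n) = n"
| "type_rank (Type_B n) = n"
| "type_rank (Type_D n) = n"
| "type_rank (Type_E n) = n"
| "type_rank Type_F4 = 4"
| "type_rank Type_H3 = 3"
| "type_rank Type_H4 = 4"
| "type_rank (Type_I2 k) = 2"

definition path_graph :: "nat \<Rightarrow> (nat set \<times> nat) set" where
  "path_graph n = {({i, i + 1}, 3) | i. 1 \<le> i \<and> i < n}"

text \<open>
  In type \<open>E\<^sub>n\<close> the branch vertex is \<open>3\<close>; its arms are \<open>2, 1\<close>, the single vertex \<open>n\<close>, and
  \<open>4, \<dots>, n - 1\<close>. Only the parameters admitted in the classification are meaningful
  (\<open>n \<ge> 1\<close>, \<open>n \<ge> 2\<close>, \<open>n \<ge> 4\<close>, \<open>n \<in> {6, 7, 8}\<close> and \<open>k \<ge> 5\<close>, respectively).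
\<close>

fun type_graph :: "coxeter_type \<Rightarrow> (nat set \<times> nat) set" where
  "type_graph (Type_A n) = path_graph n"
| "type_graph (Type_B n) = path_graph (n - 1) \<union> {({n - 1, n}, 4)}"
| "type_graph (Type_D n) = path_graph (n - 1) \<union> {({n - 2, n}, 3)}"
| "type_graph (Type_E n) = path_graph (n - 1) \<union> {({3, n}, 3)}"
| "type_graph Type_F4 = {({1, 2}, 3), ({2, 3}, 4), ({3, 4}, 3)}"
| "type_graph Type_H3 = {({1, 2}, 5), ({2, 3}, 3)}"
| "type_graph Type_H4 = {({1, 2}, 5), ({2, 3}, 3), ({3, 4}, 3)}"
| "type_graph (Type_I2 k) = {({1, 2}, k)}"

definition has_type :: "nat \<Rightarrow> (nat \<Rightarrow> nat \<Rightarrow> nat) \<Rightarrow> coxeter_type \<Rightarrow> bool" where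
  "has_type n m T \<longleftrightarrow>
     (\<exists>p. bij_betw p {1..n} {1..type_rank T} \<and>
          (\<lambda>(e, k). (p ` e, k)) ` coxeter_graph n m = type_graph T)"


section \<open>Parabolic subgroups and products of conjugates\<close>

definition conjugate_in :: "('a, 'b) monoid_scheme \<Rightarrow> 'a set \<Rightarrow> 'a set \<Rightarrow> bool" where
  "conjugate_in G H K \<longleftrightarrow> (\<exists>g\<in>carrier G. K = (g <#\<^bsub>G\<^esub> H) #>\<^bsub>G\<^esub> (inv\<^bsub>G\<^esub> g))"

definition parabolic_subgroup ::
    "('a, 'b) monoid_scheme \<Rightarrow> nat \<Rightarrow> (nat \<Rightarrow> 'a) \<Rightarrow> 'a set \<Rightarrow> bool" where
  "parabolic_subgroup C n s P \<longleftrightarrow>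
     (\<exists>I. I \<subseteq> {1..n} \<and> conjugate_in C (generate C (s ` I)) P)"

definition product_of_three_conjugates :: "('a, 'b) monoid_scheme \<Rightarrow> 'a set \<Rightarrow> bool" where
  "product_of_three_conjugates C P \<longleftrightarrow>
     (\<exists>P1 P2 P3. conjugate_in C P P1 \<and> conjugate_in C P P2 \<and> conjugate_in C P P3 \<and>
        (P1 <#>\<^bsub>C\<^esub> P2) <#>\<^bsub>C\<^esub> P3 = carrier C)"

end

theory Submission
  imports Defs Complex_Main
begin

text \<open>
  A group is a product of three conjugates of \<open>P\<close> iff it equals \<open>P x P x\<^sup>-\<^sup>1 P\<close> for some \<open>x\<close>.
  Let the Coxeter group act on the dual of its reflection representation, and let \<open>\<omega>\<close> be the
  fundamental weight fixed by the maximal parabolic \<open>P\<close>. The stabiliser of \<open>\<omega>\<close> is exactly \<open>P\<close>: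
  if two simple reflections both raise a point, then its dihedral orbit is a polygon with a highest
  point, around which the braid relation holds, so all descending paths from \<open>\<omega>\<close> to a given point
  spell the same coset of \<open>P\<close>. Hence the group equals \<open>P x P x\<^sup>-\<^sup>1 P\<close> iff any two points of the orbit
  of \<open>\<omega>\<close> have a common neighbour in the orbital graph of \<open>x\<close>.

  In types \<open>A\<close>, \<open>B\<close>, \<open>D\<close> the orbit consists of the vectors \<open>e\<^sub>k\<close> or \<open>\<plusminus>e\<^sub>k\<close>; in types \<open>E\<^sub>7\<close>, \<open>E\<^sub>8\<close>, \<open>H\<^sub>4\<close>
  it consists of the roots, neighbours being orthogonal roots; in type \<open>E\<^sub>6\<close> it has 27 points.
  Conversely, if \<open>- \<omega>\<close> lies in the orbit, then neighbours are orthogonal, and in types \<open>A\<^sub>1\<close>, \<open>B\<^sub>2\<close>,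
  \<open>H\<^sub>3\<close>, \<open>F\<^sub>4\<close> some point of the orbit has no common orthogonal neighbour with \<open>\<omega>\<close>.
\<close>

text \<open>The presentation only produces maps out of \<open>C\<close>; a priori the reflection
  action could identify elements, so existence needs an argument that the stabiliser of \<omega> is
  no larger than \<open>P\<close>. This is why cosets are carried along paths, using the braid
  relations. The common neighbour argument for nonexistence rests on the easy half, that
  \<open>P\<close> fixes \<omega>. Signs decide which firings raise a point, so the coordinates live
  in an ordered ring, and the exceptional types become finite exact computations. The integers
  suffice for labels 3 and 4, because the two entries at label 4 may be taken as 1 and 2 instead of
  twice \<open>sqrt 2\<close>; adjoining the golden ratio serves label 5. No single ring of this
  kind serves \<open>I_2(m)\<close> for all \<open>m\<close>; there a count of points in the complex
  plane replaces orthogonality.\<close>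

section \<open>Actions of presented groups\<close>

text \<open>The exponent of a letter is ignored, since every \<open>\<tau> x\<close> will be an
  involution.\<close>

definition word_act :: "('x \<Rightarrow> 'y \<Rightarrow> 'y) \<Rightarrow> 'x word \<Rightarrow> 'y \<Rightarrow> 'y" where
  "word_act \<tau> w = foldr (\<lambda>(x, b). \<tau> x) w"

lemma word_act_simps [simp]:
  "word_act \<tau> [] = id"
  "word_act \<tau> ((x, b) # w) = \<tau> x \<circ> word_act \<tau> w"
  "word_act \<tau> (u @ w) = word_act \<tau> u \<circ> word_act \<tau> w"
  by (simp_all add: word_act_def fun_eq_iff)

lemma word_act_replicate:
  "word_act \<tau> (concat (replicate k w)) = word_act \<tau> w ^^ k"
  by (induction k) simp_all

lemma word_act_cong_presented:
  assumes "presented_eq X R u v"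
    and "\<And>x. x \<in> X \<Longrightarrow> \<tau> x \<circ> \<tau> x = id" and "\<And>r. r \<in> R \<Longrightarrow> word_act \<tau> r = id"
  shows "word_act \<tau> u = word_act \<tau> v"
  using assms(1) by induction (simp_all add: assms)

context group
begin

lemma word_value_Cons [simp]:
  "word_value G f ((x, b) # w) = (if b then f x else inv (f x)) \<otimes> word_value G f w"
  by (simp add: word_value_def)

lemma word_value_Nil [simp]: "word_value G f [] = \<one>"
  by (simp add: word_value_def)

lemma word_value_closed:
  assumes "f ` X \<subseteq> carrier G" "w \<in> words X"
  shows "word_value G f w \<in> carrier G"
  using assms(2)
proof (induction w)
  case (Cons a w)
  then show ?case using assms(1) by (cases a) (auto simp: words_def)
qed simp

lemma word_value_append:
  assumes "f ` X \<subseteq> carrier G" "u \<in> words X" "w \<in> words X"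
  shows "word_value G f (u @ w) = word_value G f u \<otimes> word_value G f w"
  using assms(2)
proof (induction u)
  case Nil
  then show ?case using word_value_closed[OF assms(1,3)] by simp
next
  case (Cons a u)
  then show ?case
    using assms(1) word_value_closed[OF assms(1,3)] word_value_closed[OF assms(1), of u]
    by (cases a) (auto simp: words_def m_assoc)
qed

lemma generate_word_value:
  assumes "f ` X \<subseteq> carrier G" "g \<in> generate G (f ` X)"
  shows "\<exists>w\<in>words X. word_value G f w = g"
  using assms(2)
proof induction
  case one
  then show ?case by (intro bexI[of _ "[]"]) (auto simp: words_def)
next
  case (incl h)
  then obtain x where "x \<in> X" "h = f x" by blast
  then show ?case using assms(1) by (intro bexI[of _ "[(x, True)]"]) (auto simp: words_def)
next
  case (inv h)
  then obtain x where "x \<in> X" "h = f x" by blast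
  then show ?case using assms(1) by (intro bexI[of _ "[(x, False)]"]) (auto simp: words_def)
next
  case (eng h1 h2)
  then obtain u w where "u \<in> words X" "word_value G f u = h1" "w \<in> words X" "word_value G f w = h2"
    by blast
  then show ?case using assms(1)
    by (intro bexI[of _ "u @ w"]) (auto simp: words_def word_value_append[unfolded words_def])
qed

end

text \<open>The universal property of the presentation: \<open>g\<close> acts through a chosen word
  \<open>W g\<close>, and the choice does not matter because words of equal value are
  \<open>presented_eq\<close> and hence act alike.\<close>

lemma presentation_action:
  assumes "has_presentation G X f R"
    and \<tau>: "\<And>x. x \<in> X \<Longrightarrow> \<tau> x \<circ> \<tau> x = id" and R: "\<And>r. r \<in> R \<Longrightarrow> word_act \<tau> r = id"
  obtains \<rho> where "\<And>x. x \<in> X \<Longrightarrow> \<rho> (f x) = \<tau> x"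
    and "\<And>g h. g \<in> carrier G \<Longrightarrow> h \<in> carrier G \<Longrightarrow> \<rho> (g \<otimes>\<^bsub>G\<^esub> h) = \<rho> g \<circ> \<rho> h"
proof -
  interpret group G using assms(1) by (simp add: has_presentation_def)
  have f: "f ` X \<subseteq> carrier G" and gen: "generate G (f ` X) = carrier G"
    and eq: "\<And>u v. u \<in> words X \<Longrightarrow> v \<in> words X \<Longrightarrow>
      word_value G f u = word_value G f v \<longleftrightarrow> presented_eq X R u v"
    using assms(1) by (auto simp: has_presentation_def)
  define W where "W g = (SOME w. w \<in> words X \<and> word_value G f w = g)" for g
  have W: "W g \<in> words X \<and> word_value G f (W g) = g" if "g \<in> carrier G" for g
  proof -
    have "\<exists>w. w \<in> words X \<and> word_value G f w = g"
      using generate_word_value[OF f, of g] gen that by blast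
    then show ?thesis unfolding W_def by (rule someI_ex)
  qed
  have same: "word_act \<tau> u = word_act \<tau> v"
    if "u \<in> words X" "v \<in> words X" "word_value G f u = word_value G f v" for u v
    using word_act_cong_presented[OF _ \<tau> R] eq that by blast
  show thesis
  proof (rule that[of "\<lambda>g. word_act \<tau> (W g)"])
    fix x assume "x \<in> X"
    then have "[(x, True)] \<in> words X" "f x \<in> carrier G" "word_value G f [(x, True)] = f x"
      using f by (auto simp: words_def)
    then have "word_act \<tau> (W (f x)) = word_act \<tau> [(x, True)]"
      using W same by metis
    then show "word_act \<tau> (W (f x)) = \<tau> x" by simp
  next
    fix g h assume gh: "g \<in> carrier G" "h \<in> carrier G"
    have "W g @ W h \<in> words X" "word_value G f (W g @ W h) = g \<otimes>\<^bsub>G\<^esub> h"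
      using W gh word_value_append[OF f] by (auto simp: words_def)
    then have "word_act \<tau> (W (g \<otimes>\<^bsub>G\<^esub> h)) = word_act \<tau> (W g @ W h)"
      using W gh same by (metis m_closed)
    then show "word_act \<tau> (W (g \<otimes>\<^bsub>G\<^esub> h)) = word_act \<tau> (W g) \<circ> word_act \<tau> (W h)" by simp
  qed
qed

section \<open>The numbers game\<close>

text \<open>
  The value \<open>c i\<close> is the pairing of a vector with the \<open>i\<close>-th simple coroot, and \<open>- a i j\<close> are the
  entries of a Cartan matrix; firing \<open>i\<close> is the \<open>i\<close>-th simple reflection.
\<close>

definition fire :: "(nat \<Rightarrow> nat \<Rightarrow> 'r::linordered_idom) \<Rightarrow> nat \<Rightarrow> (nat \<Rightarrow> 'r) \<Rightarrow> nat \<Rightarrow> 'r" where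
  "fire a i c = (\<lambda>l. if l = i then - c i else c l + a i l * c i)"

lemma fire_fire [simp]: "fire a i (fire a i c) = c"
  by (auto simp: fire_def fun_eq_iff)

lemma fire_zero: "c i = 0 \<Longrightarrow> fire a i c = c"
  by (auto simp: fire_def fun_eq_iff)

lemma fire_same [simp]: "fire a i c i = - c i"
  by (simp add: fire_def)

primrec alt_fire :: "(nat \<Rightarrow> nat \<Rightarrow> 'r::linordered_idom) \<Rightarrow> nat \<Rightarrow> nat \<Rightarrow> nat \<Rightarrow> (nat \<Rightarrow> 'r) \<Rightarrow> nat \<Rightarrow> 'r" where
  "alt_fire a 0 i j c = c"
| "alt_fire a (Suc k) i j c = alt_fire a k j i (fire a i c)"

text \<open>A negative value \<open>c i\<close> means that firing \<open>i\<close> adds a positive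
  multiple of the \<open>i\<close>-th simple root, so the alternating path goes up at each
  step.\<close>

primrec ascending :: "(nat \<Rightarrow> nat \<Rightarrow> 'r::linordered_idom) \<Rightarrow> nat \<Rightarrow> nat \<Rightarrow> nat \<Rightarrow> (nat \<Rightarrow> 'r) \<Rightarrow> bool" where
  "ascending a 0 i j c \<longleftrightarrow> True"
| "ascending a (Suc k) i j c \<longleftrightarrow> c i < 0 \<and> ascending a k j i (fire a i c)"

text \<open>The condition is \<open>a i j * a j i = 4 cos\<^sup>2 (\<pi> / m)\<close>.\<close>

definition bond :: "(nat \<Rightarrow> nat \<Rightarrow> 'r::linordered_idom) \<Rightarrow> nat \<Rightarrow> nat \<Rightarrow> nat \<Rightarrow> bool" where
  "bond a m i j \<longleftrightarrow>
     m = 2 \<and> a i j = 0 \<and> a j i = 0 \<or>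
     m = 3 \<and> a i j = 1 \<and> a j i = 1 \<or>
     m = 4 \<and> 0 < a i j \<and> 0 < a j i \<and> a i j * a j i = 2 \<or>
     m = 5 \<and> 0 < a i j \<and> a j i = a i j \<and> a i j * a i j = a i j + 1"

lemma bond_sym: "bond a m i j \<Longrightarrow> bond a m j i"
  by (auto simp: bond_def mult.commute)

lemma bond_cases [consumes 1, case_names 2 3 4 5]:
  assumes "bond a m i j"
  obtains "m = 2" "a i j = 0" "a j i = 0"
  | "m = 3" "a i j = 1" "a j i = 1"
  | "m = 4" "0 < a i j" "0 < a j i" "a i j * a j i = 2"
  | "m = 5" "0 < a i j" "a j i = a i j" "a i j * a i j = a i j + 1"
  using assms unfolding bond_def by blast

text \<open>The configurations reached from \<open>c\<close> by firing only \<open>i\<close> and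
  \<open>j\<close>: \<open>x\<close> and \<open>y\<close> are the current values there,
  \<open>u\<close> and \<open>v\<close> the accumulated fired amounts, which determine all other
  values. Identities between such firings become identities between four ring elements.\<close>

definition rank2 :: "(nat \<Rightarrow> nat \<Rightarrow> 'r::linordered_idom) \<Rightarrow> (nat \<Rightarrow> 'r) \<Rightarrow> nat \<Rightarrow> nat \<Rightarrow>
    'r \<Rightarrow> 'r \<Rightarrow> 'r \<Rightarrow> 'r \<Rightarrow> nat \<Rightarrow> 'r" where
  "rank2 a c i j x y u v =
     (\<lambda>l. if l = i then x else if l = j then y else c l + a i l * u + a j l * v)"

lemma rank2_init: "rank2 a c i j (c i) (c j) 0 0 = c"
  by (simp add: rank2_def fun_eq_iff)

lemma rank2_at: "rank2 a c i j x y u v i = x" "i \<noteq> j \<Longrightarrow> rank2 a c i j x y u v j = y"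
  by (simp_all add: rank2_def)

lemma fire_rank2:
  assumes "i \<noteq> j"
  shows "fire a i (rank2 a c i j x y u v) = rank2 a c i j (- x) (y + a i j * x) (u + x) v"
    and "fire a j (rank2 a c i j x y u v) = rank2 a c i j (x + a j i * y) (- y) u (v + y)"
  using assms by (auto simp: fire_def rank2_def fun_eq_iff algebra_simps)

lemma bond_mult:
  fixes a :: "nat \<Rightarrow> nat \<Rightarrow> 'r::linordered_idom"
  assumes "a i j * a j i = 2"
  shows "a i j * (a j i * x) = 2 * x" "a j i * (a i j * x) = 2 * x"
  using assms by (simp_all add: mult.assoc[symmetric] mult.commute[of "a j i" "a i j"])

lemma bond_mult_golden:
  fixes p :: "'r::linordered_idom"
  assumes "p * p = p + 1"
  shows "p * (p * x) = p * x + x"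
  using assms by (simp add: mult.assoc[symmetric] distrib_right)

lemma alt_fire_eq:
  assumes "i \<noteq> j" and "bond a m i j"
  shows "alt_fire a m i j c = alt_fire a m j i c"
proof -
  have "alt_fire a m i j (rank2 a c i j x y 0 0) = alt_fire a m j i (rank2 a c i j x y 0 0)" for x y
    using assms(2)
  proof (cases rule: bond_cases)
    case 2
    then show ?thesis by (simp add: numeral_eq_Suc fire_rank2[OF assms(1)])
  next
    case 3
    then show ?thesis by (simp add: numeral_eq_Suc fire_rank2[OF assms(1)] add_ac)
  next
    case 4
    then show ?thesis
      by (simp add: numeral_eq_Suc fire_rank2[OF assms(1)]
          algebra_simps bond_mult[of a i j, OF 4(4)])
  next
    case 5
    then show ?thesis
      by (simp add: numeral_eq_Suc fire_rank2[OF assms(1)] algebra_simps bond_mult_golden[OF 5(4)])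
  qed
  from this[of "c i" "c j"] show ?thesis by (simp only: rank2_init)
qed

text \<open>The values fired along the path are the pairings with the positive coroots of the rank
  two system, hence nonnegative combinations of \<open>x\<close> and \<open>y\<close>. Only the last
  of the \<open>m\<close> is \<open>y\<close> alone; the others involve \<open>x\<close> and are
  strictly negative.\<close>

lemma ascending_rank2:
  assumes "i \<noteq> j" and "bond a m i j" and "x < 0" "y \<le> 0"
  shows "ascending a (m - 1) i j (rank2 a c i j x y 0 0)"
    and "y < 0 \<Longrightarrow> ascending a m i j (rank2 a c i j x y 0 0)"
proof -
  note simps = numeral_eq_Suc fire_rank2[OF assms(1)] rank2_at rank2_at(2)[OF assms(1)]
  have "ascending a (m - 1) i j (rank2 a c i j x y 0 0) \<and>
    (y < 0 \<longrightarrow> ascending a m i j (rank2 a c i j x y 0 0))"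
    using assms(2)
  proof (cases rule: bond_cases)
    case 2
    then show ?thesis using assms by (simp add: simps)
  next
    case 3
    then show ?thesis using assms by (simp add: simps)
  next
    case 4
    have "a i j * x < 0" "a j i * y \<le> 0" "y < 0 \<Longrightarrow> a j i * y < 0"
      using 4 assms by (simp_all add: mult_less_0_iff mult_le_0_iff)
    then show ?thesis using 4 assms by (simp add: simps algebra_simps bond_mult[of a i j, OF 4(4)])
  next
    case 5
    have "a i j * x < 0" "a i j * y \<le> 0" "y < 0 \<Longrightarrow> a i j * y < 0"
      using 5 assms by (simp_all add: mult_less_0_iff mult_le_0_iff)
    then show ?thesis using 5 assms by (simp add: simps algebra_simps bond_mult_golden[OF 5(4)])
  qed
  then show "ascending a (m - 1) i j (rank2 a c i j x y 0 0)"
    "y < 0 \<Longrightarrow> ascending a m i j (rank2 a c i j x y 0 0)" by auto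
qed

lemma ascending_pred:
  assumes "i \<noteq> j" and "bond a m i j" and "c i < 0" "c j \<le> 0"
  shows "ascending a (m - 1) i j c"
  using ascending_rank2(1)[OF assms, of c] by (simp only: rank2_init)

lemma ascending_full:
  assumes "i \<noteq> j" and "bond a m i j" and "c i < 0" "c j < 0"
  shows "ascending a m i j c"
  using ascending_rank2(2)[OF assms(1-3) less_imp_le[OF assms(4)] assms(4), of c]
  by (simp only: rank2_init)

lemma fire_order:
  assumes "i \<noteq> j" and "bond a m i j"
  shows "(fire a i \<circ> fire a j) ^^ m = id"
proof
  fix c
  \<comment> \<open>The right side fires \<open>j\<close> twice in a row, so an alternating path of
    \<open>m + 1\<close> firings equals one of \<open>m - 1\<close>; the remaining firings of the
    full cycle undo the latter.\<close>
  have "alt_fire a m i j (fire a j c) = alt_fire a m j i (fire a j c)"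
    by (rule alt_fire_eq[OF assms])
  moreover have "m \<in> {2, 3, 4, 5}" using assms(2) by (auto simp: bond_def)
  ultimately show "((fire a i \<circ> fire a j) ^^ m) c = id c"
    by (auto simp: numeral_eq_Suc)
qed

section \<open>Stabilisers of fundamental weights\<close>

context group
begin

primrec alt_mult :: "(nat \<Rightarrow> 'a) \<Rightarrow> nat \<Rightarrow> nat \<Rightarrow> nat \<Rightarrow> 'a set \<Rightarrow> 'a set" where
  "alt_mult t 0 i j A = A"
| "alt_mult t (Suc k) i j A = alt_mult t k j i (t i <# A)"

lemma l_coset_cancel:
  assumes "x \<in> carrier G" "x \<otimes> x = \<one>" "A \<subseteq> carrier G"
  shows "x <# (x <# A) = A"
  using assms by (simp add: lcos_m_assoc lcos_mult_one)

text \<open>Right multiplication by a suitable alternating word turns one side into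
  \<open>(x \<otimes> y) [^] m\<close> and collapses the other by cancelling squares.\<close>

lemma braid_of_order:
  assumes c: "x \<in> carrier G" "y \<in> carrier G" "x \<otimes> x = \<one>" "y \<otimes> y = \<one>"
    and rel: "(x \<otimes> y) [^] (m::nat) = \<one>"
  shows "m = 2 \<Longrightarrow> x \<otimes> y = y \<otimes> x"
    and "m = 3 \<Longrightarrow> x \<otimes> (y \<otimes> x) = y \<otimes> (x \<otimes> y)"
    and "m = 4 \<Longrightarrow> x \<otimes> (y \<otimes> (x \<otimes> y)) = y \<otimes> (x \<otimes> (y \<otimes> x))"
    and "m = 5 \<Longrightarrow> x \<otimes> (y \<otimes> (x \<otimes> (y \<otimes> x))) = y \<otimes> (x \<otimes> (y \<otimes> (x \<otimes> y)))"
proof -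
  have xx: "x \<otimes> (x \<otimes> z) = z" and yy: "y \<otimes> (y \<otimes> z) = z" if "z \<in> carrier G" for z
    using that c by (simp_all flip: m_assoc)
  have ca: "u = v" if "u \<otimes> w = \<one>" "v \<otimes> w = \<one>" "u \<in> carrier G" "v \<in> carrier G" "w \<in> carrier G" for u v w
    using that right_cancel[of w u v] by simp
  show "m = 2 \<Longrightarrow> x \<otimes> y = y \<otimes> x"
    by (rule ca[where w = "x \<otimes> y"]) (insert rel c xx yy, simp_all add: numeral_eq_Suc m_assoc)
  show "m = 3 \<Longrightarrow> x \<otimes> (y \<otimes> x) = y \<otimes> (x \<otimes> y)"
    by (rule ca[where w = "y \<otimes> (x \<otimes> y)"])
      (insert rel c xx yy, simp_all add: numeral_eq_Suc m_assoc)
  show "m = 4 \<Longrightarrow> x \<otimes> (y \<otimes> (x \<otimes> y)) = y \<otimes> (x \<otimes> (y \<otimes> x))"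
    by (rule ca[where w = "x \<otimes> (y \<otimes> (x \<otimes> y))"])
      (insert rel c xx yy, simp_all add: numeral_eq_Suc m_assoc)
  show "m = 5 \<Longrightarrow> x \<otimes> (y \<otimes> (x \<otimes> (y \<otimes> x))) = y \<otimes> (x \<otimes> (y \<otimes> (x \<otimes> y)))"
    by (rule ca[where w = "y \<otimes> (x \<otimes> (y \<otimes> (x \<otimes> y)))"])
      (insert rel c xx yy, simp_all add: numeral_eq_Suc m_assoc)
qed

lemma alt_mult_eq:
  assumes c: "t i \<in> carrier G" "t j \<in> carrier G" "t i \<otimes> t i = \<one>" "t j \<otimes> t j = \<one>"
    and rel: "(t i \<otimes> t j) [^] m = \<one>" and m: "m \<in> {2, 3, 4, 5}" and A: "A \<subseteq> carrier G"
  shows "alt_mult t m i j A = alt_mult t m j i A"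
proof -
  note b = braid_of_order[OF c rel]
  from m consider "m = 2" | "m = 3" | "m = 4" | "m = 5" by blast
  then show ?thesis
  proof cases
    case 1
    then show ?thesis using c(1,2) A by (simp add: numeral_eq_Suc lcos_m_assoc, simp only: b(1)[OF 1])
  next
    case 2
    then show ?thesis using c(1,2) A
      by (simp add: numeral_eq_Suc lcos_m_assoc m_assoc, simp only: b(2)[OF 2])
  next
    case 3
    then show ?thesis using c(1,2) A
      by (simp add: numeral_eq_Suc lcos_m_assoc m_assoc, simp only: b(3)[OF 3])
  next
    case 4
    then show ?thesis using c(1,2) A
      by (simp add: numeral_eq_Suc lcos_m_assoc m_assoc, simp only: b(4)[OF 4])
  qed
qed

lemma l_coset_inj:
  assumes "x \<in> carrier G" "x \<otimes> x = \<one>" "A \<subseteq> carrier G" "B \<subseteq> carrier G" "x <# A = x <# B"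
  shows "A = B"
proof -
  have "A = x <# (x <# A)" by (rule l_coset_cancel[OF assms(1-3), symmetric])
  also have "\<dots> = x <# (x <# B)" by (simp only: assms(5))
  also have "\<dots> = B" by (rule l_coset_cancel[OF assms(1,2,4)])
  finally show ?thesis .
qed

end

section \<open>Words in the generators and their action on configurations\<close>

definition fires :: "(nat \<Rightarrow> nat \<Rightarrow> 'r::linordered_idom) \<Rightarrow> nat list \<Rightarrow> (nat \<Rightarrow> 'r) \<Rightarrow> nat \<Rightarrow> 'r" where
  "fires a w = foldr (fire a) w"

lemma fires_simps [simp]:
  "fires a [] = id" "fires a (i # w) = fire a i \<circ> fires a w" "fires a (u @ w) = fires a u \<circ> fires a w"
  by (simp_all add: fires_def fun_eq_iff)

text \<open>\<open>rev x\<close> plays the inverse of \<open>x\<close>, so these are the points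
  \<open>p x q x^-1 \<omega>\<close> with \<open>p\<close> and \<open>q\<close> in the parabolic
  generated by \<open>I\<close>.\<close>

definition reached ::
    "(nat \<Rightarrow> nat \<Rightarrow> 'r::linordered_idom) \<Rightarrow> nat set \<Rightarrow> (nat \<Rightarrow> 'r) \<Rightarrow> nat list \<Rightarrow> (nat \<Rightarrow> 'r) \<Rightarrow> bool" where
  "reached a I \<omega> x z \<longleftrightarrow>
     (\<exists>p q. set p \<subseteq> I \<and> set q \<subseteq> I \<and> z = fires a (p @ x @ q @ rev x) \<omega>)"

locale coxeter_action = group G for G :: "('a, 'b) monoid_scheme" (structure) +
  fixes N :: "nat set" and t :: "nat \<Rightarrow> 'a" and M :: "nat \<Rightarrow> nat \<Rightarrow> nat"
    and a :: "nat \<Rightarrow> nat \<Rightarrow> 'r::linordered_idom" and \<rho> :: "'a \<Rightarrow> (nat \<Rightarrow> 'r) \<Rightarrow> nat \<Rightarrow> 'r"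
  assumes nodes: "N \<noteq> {}"
    and t_closed [simp]: "i \<in> N \<Longrightarrow> t i \<in> carrier G"
    and t_square [simp]: "i \<in> N \<Longrightarrow> t i \<otimes> t i = \<one>"
    and t_order: "i \<in> N \<Longrightarrow> j \<in> N \<Longrightarrow> i \<noteq> j \<Longrightarrow> (t i \<otimes> t j) [^] M i j = \<one>"
    and bonds: "i \<in> N \<Longrightarrow> j \<in> N \<Longrightarrow> i \<noteq> j \<Longrightarrow> bond a (M i j) i j"
    and t_generate: "generate G (t ` N) = carrier G"
    and \<rho>_t: "i \<in> N \<Longrightarrow> \<rho> (t i) = fire a i"
    and \<rho>_mult: "g \<in> carrier G \<Longrightarrow> h \<in> carrier G \<Longrightarrow> \<rho> (g \<otimes> h) = \<rho> g \<circ> \<rho> h"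
begin

lemma \<rho>_one [simp]: "\<rho> \<one> = id"
proof -
  obtain i where i: "i \<in> N" using nodes by blast
  then have "\<rho> (t i \<otimes> t i) = fire a i \<circ> fire a i" by (simp add: \<rho>_mult \<rho>_t del: t_square)
  then show ?thesis using i by (simp add: fun_eq_iff)
qed

definition val :: "nat list \<Rightarrow> 'a" where
  "val w = foldr (\<lambda>i g. t i \<otimes> g) w \<one>"

abbreviation "act \<equiv> fires a"

lemma val_simps [simp]: "val [] = \<one>" "val (i # w) = t i \<otimes> val w"
  by (simp_all add: val_def)

lemma val_closed [simp]: "set w \<subseteq> N \<Longrightarrow> val w \<in> carrier G"
  by (induction w) simp_all

lemma val_append [simp]:
  "set u \<subseteq> N \<Longrightarrow> set w \<subseteq> N \<Longrightarrow> val (u @ w) = val u \<otimes> val w"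
  by (induction u) (simp_all add: m_assoc)

lemma inv_t: "i \<in> N \<Longrightarrow> inv (t i) = t i"
  by (rule inv_equality) simp_all

lemma val_rev: "set w \<subseteq> N \<Longrightarrow> val (rev w) = inv (val w)"
proof (induction w)
  case (Cons i w)
  with Cons show ?case by (simp add: inv_mult_group inv_t)
qed simp

lemma \<rho>_val: "set w \<subseteq> N \<Longrightarrow> \<rho> (val w) = act w"
  by (induction w) (simp_all add: \<rho>_mult \<rho>_t)

lemma generate_val:
  assumes "I \<subseteq> N" "g \<in> generate G (t ` I)"
  shows "\<exists>w. set w \<subseteq> I \<and> val w = g"
  using assms(2)
proof induction
  case one
  then show ?case by (intro exI[of _ "[]"]) simp
next
  case (incl h)
  then obtain i where i: "i \<in> I" "h = t i" by blast
  with assms(1) have "i \<in> N" "val [i] = t i" by auto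
  with i show ?case by (intro exI[of _ "[i]"]) simp
next
  case (inv h)
  then obtain i where i: "i \<in> I" "h = t i" by blast
  with assms(1) have "i \<in> N" "val [i] = t i" by auto
  with i show ?case by (intro exI[of _ "[i]"]) (simp add: inv_t)
next
  case (eng h1 h2)
  then obtain u w where "set u \<subseteq> I" "val u = h1" "set w \<subseteq> I" "val w = h2" by blast
  moreover from this have "val (u @ w) = val u \<otimes> val w"
    using assms(1) by (intro val_append subset_trans[OF _ assms(1)])
  ultimately show ?case by (intro exI[of _ "u @ w"]) simp
qed

lemma val_generate: "I \<subseteq> N \<Longrightarrow> set w \<subseteq> I \<Longrightarrow> val w \<in> generate G (t ` I)"
  by (induction w) (simp_all add: generate.one generate.eng generate.incl)

lemma carrier_val: "g \<in> carrier G \<Longrightarrow> \<exists>w. set w \<subseteq> N \<and> val w = g"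
  using generate_val[of N g] t_generate by simp

text \<open>\<open>A\<close> is the coset spelled by a descending path of length \<open>k\<close>
  from \<open>\<omega>\<close> to \<open>z\<close>. It is kept as a relation because independence of
  the path is what has to be shown.\<close>

inductive descends :: "(nat \<Rightarrow> 'r) \<Rightarrow> 'a set \<Rightarrow> nat \<Rightarrow> (nat \<Rightarrow> 'r) \<Rightarrow> 'a set \<Rightarrow> bool"
  for \<omega> :: "nat \<Rightarrow> 'r" and P :: "'a set" where
  start: "descends \<omega> P 0 \<omega> P"
| step: "descends \<omega> P k z A \<Longrightarrow> i \<in> N \<Longrightarrow> 0 < z i \<Longrightarrow> descends \<omega> P (Suc k) (fire a i z) (t i <# A)"

lemma parabolic_absorb:
  assumes "I \<subseteq> N" "set w \<subseteq> I"
  shows "val w <# generate G (t ` I) = generate G (t ` I)"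
proof -
  have "t ` I \<subseteq> carrier G" using assms(1) by auto
  then have "subgroup (generate G (t ` I)) G" by (rule generate_is_subgroup)
  then show ?thesis using coset_join3 val_generate[OF assms] val_closed assms by (meson subset_trans)
qed

lemma act_fixed: "(\<And>i. i \<in> set w \<Longrightarrow> \<omega> i = 0) \<Longrightarrow> act w \<omega> = \<omega>"
  by (induction w) (simp_all add: fire_zero)

end

section \<open>Descending paths determine cosets\<close>

locale coset_game = coxeter_action +
  fixes \<omega> :: "nat \<Rightarrow> 'c" and P :: "'a set"
  assumes P_subset: "P \<subseteq> carrier G" and dominant: "i \<in> N \<Longrightarrow> 0 \<le> \<omega> i"
    and P_absorb: "i \<in> N \<Longrightarrow> \<omega> i = 0 \<Longrightarrow> t i <# P = P"
begin

lemma descends_subset: "descends \<omega> P k z A \<Longrightarrow> A \<subseteq> carrier G"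
  by (induction rule: descends.induct) (simp_all add: P_subset l_coset_subset_G)

lemma alt_mult_inj:
  "alt_mult t k i j A = alt_mult t k i j B \<Longrightarrow> A \<subseteq> carrier G \<Longrightarrow> B \<subseteq> carrier G \<Longrightarrow>
   i \<in> N \<Longrightarrow> j \<in> N \<Longrightarrow> A = B"
proof (induction k arbitrary: i j A B)
  case (Suc k)
  then have "t i <# A = t i <# B" by (simp add: l_coset_subset_G)
  with Suc.prems show ?case using l_coset_inj[OF t_closed t_square] by blast
qed simp

lemma braid:
  assumes "i \<in> N" "j \<in> N" "i \<noteq> j" "A \<subseteq> carrier G"
  shows "alt_mult t (M i j) i j A = alt_mult t (M i j) j i A"
proof -
  have "M i j \<in> {2, 3, 4, 5}" using bonds[OF assms(1-3)] by (auto simp: bond_def)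
  then show ?thesis using assms by (intro alt_mult_eq) (simp_all add: t_order)
qed

text \<open>An ascending alternating path read backwards descends; this goes down the second side of
  a dihedral polygon.\<close>

lemma climb_back:
  "ascending a k i j z \<Longrightarrow> descends \<omega> P l (alt_fire a k i j z) (alt_mult t k i j A) \<Longrightarrow>
   A \<subseteq> carrier G \<Longrightarrow> i \<in> N \<Longrightarrow> j \<in> N \<Longrightarrow> descends \<omega> P (l + k) z A"
proof (induction k arbitrary: i j z A)
  case (Suc k)
  then have "descends \<omega> P (l + k) (fire a i z) (t i <# A)"
    using Suc.IH[of j i "fire a i z" "t i <# A"] by (simp add: l_coset_subset_G)
  from step[OF this, of i] Suc.prems show ?case by (simp add: l_coset_cancel)
qed simp

text \<open>Climbing one step is a hypothesis restricted to \<open>k < b\<close>, so that the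
  induction hypothesis of \<open>descends_climb\<close> can be plugged in.\<close>

lemma descends_climbs_below:
  assumes climb: "\<And>k z A i. k < b \<Longrightarrow> descends \<omega> P k z A \<Longrightarrow> i \<in> N \<Longrightarrow> z i < 0 \<Longrightarrow>
      0 < k \<and> descends \<omega> P (k - 1) (fire a i z) (t i <# A)"
    and "k < b" "descends \<omega> P k z A" "ascending a l i j z" "i \<in> N" "j \<in> N"
  shows "l \<le> k \<and> descends \<omega> P (k - l) (alt_fire a l i j z) (alt_mult t l i j A)"
  using assms(2-)
proof (induction l arbitrary: k i j z A)
  case (Suc l)
  then have 1: "0 < k" "descends \<omega> P (k - 1) (fire a i z) (t i <# A)"
    using climb[of k z A i] by simp_all
  with Suc.IH[of "k - 1" "fire a i z" "t i <# A" j i] Suc.prems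
  have "l \<le> k - 1" "descends \<omega> P (k - 1 - l) (alt_fire a (Suc l) i j z) (alt_mult t (Suc l) i j A)"
    by simp_all
  then show ?case using 1 by (simp add: Suc_le_eq)
qed simp

text \<open>If the path arrived by another node \<open>j\<close>, both \<open>i\<close> and
  \<open>j\<close> raise \<open>z\<close>, which is thus the lowest point of its dihedral polygon.
  The induction hypothesis climbs the \<open>j\<close> side to the top, the braid relation
  identifies point and coset there with those of the \<open>i\<close> side, and
  \<open>climb_back\<close> comes down that side to \<open>fire a i z\<close>. Both sides have
  \<open>m\<close> steps, so the lengths agree.\<close>

lemma descends_climb:
  "descends \<omega> P k z A \<Longrightarrow> i \<in> N \<Longrightarrow> z i < 0 \<Longrightarrow>
   0 < k \<and> descends \<omega> P (k - 1) (fire a i z) (t i <# A)"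
proof (induction k arbitrary: z A i rule: less_induct)
  case (less k)
  from less.prems(1) show ?case
  proof cases
    case start
    then show ?thesis using dominant less.prems by force
  next
    case (step k' z' A' j)
    have A: "A' \<subseteq> carrier G" "A \<subseteq> carrier G"
      using descends_subset step(4) less.prems(1) by blast+
    have z': "fire a j z = z'" and A': "t j <# A = A'"
      using step A by (simp_all add: l_coset_cancel)
    show ?thesis
    proof (cases "i = j")
      case True
      then show ?thesis using step z' A' by simp
    next
      case False
      define m where "m = M i j"
      have b: "bond a m i j" using bonds less.prems(2) step(5) False by (simp add: m_def)
      then obtain n where n: "m = Suc n" by (cases m) (auto simp: bond_def)
      have zj: "z j < 0" using step by simp
      have asc: "ascending a m j i z" "ascending a m i j z"
        using ascending_full[OF _ b] ascending_full[OF _ bond_sym[OF b]] less.prems zj False by auto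
      \<comment> \<open>The step from \<open>z\<close> to \<open>z'\<close> is the first of the
        \<open>m\<close> ascending ones, so \<open>n = m - 1\<close> remain.\<close>
      have "n \<le> k' \<and> descends \<omega> P (k' - n) (alt_fire a n i j z') (alt_mult t n i j A')"
        using descends_climbs_below[where k = k' and z = z' and A = A' and l = n and i = i and j = j,
            OF less.IH] step less.prems(2) asc(1) z' n
        by auto
      moreover have "alt_fire a n i j z' = alt_fire a n j i (fire a i z)"
        using alt_fire_eq[OF False b, of z] z' n by simp
      moreover have "alt_mult t n i j A' = alt_mult t n j i (t i <# A)"
        using braid[OF less.prems(2) step(5) False A(2)] A' n by (simp add: m_def)
      ultimately have d: "n \<le> k'" "descends \<omega> P (k' - n) (alt_fire a n j i (fire a i z))
          (alt_mult t n j i (t i <# A))" by simp_all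
      have "ascending a n j i (fire a i z)" using asc(2) n by simp
      from climb_back[OF this d(2)] d(1) show ?thesis
        using less.prems(2) step A by (simp add: l_coset_subset_G)
    qed
  qed
qed

lemma descends_climbs:
  assumes "descends \<omega> P k z A" "ascending a l i j z" "i \<in> N" "j \<in> N"
  shows "l \<le> k \<and> descends \<omega> P (k - l) (alt_fire a l i j z) (alt_mult t l i j A)"
  using descends_climbs_below[where b = "Suc k", OF descends_climb _ assms] by simp

lemma alt_fire_Suc: "alt_fire a (Suc k) i j z = fire a (if even k then i else j) (alt_fire a k i j z)"
  by (induction k arbitrary: i j z) auto

lemma alt_mult_Suc: "alt_mult t (Suc k) i j A = t (if even k then i else j) <# alt_mult t k i j A"
  by (induction k arbitrary: i j A) auto

lemma fire_fixed: "fire a i z = z \<Longrightarrow> z i = 0"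
  using fire_same[of a i z] by simp

text \<open>Here the dihedral polygon is degenerate: \<open>z\<close> is fixed by \<open>i\<close>
  and raised by the last node \<open>j\<close>. Climbing \<open>m - 1\<close> steps leads to a point
  fixed by \<open>i\<close> or \<open>j\<close>, to which the induction hypothesis applies; the
  braid relation carries the conclusion back down.\<close>

lemma descends_fixed:
  "descends \<omega> P k z A \<Longrightarrow> i \<in> N \<Longrightarrow> z i = 0 \<Longrightarrow> t i <# A = A"
proof (induction k arbitrary: z A i rule: less_induct)
  case (less k)
  from less.prems(1) show ?case
  proof cases
    case start
    then show ?thesis using P_absorb less.prems by simp
  next
    case (step k' z' A' j)
    have A: "A \<subseteq> carrier G" using descends_subset less.prems(1) by blast
    have zj: "z j < 0" using step by simp
    then have False: "i \<noteq> j" using less.prems(3) by auto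
    define m where "m = M i j"
    have b: "bond a m i j" using bonds less.prems(2) step(5) False by (simp add: m_def)
    then obtain n where n: "m = Suc n" "0 < n" by (cases m) (auto simp: bond_def)
    have asc: "ascending a n j i z"
      using ascending_pred[OF _ bond_sym[OF b]] less.prems zj False n by simp
    \<comment> \<open>\<open>l\<close> is the letter that would continue the alternating path beyond
      \<open>T\<close>. Since \<open>i\<close> fixes \<open>z\<close>, the two paths of length
      \<open>m\<close> show that firing \<open>l\<close> leaves \<open>T\<close> unchanged.\<close>
    define T B l where "T = alt_fire a n j i z" and "B = alt_mult t n j i A"
      and "l = (if even n then j else i)"
    have d: "n \<le> k" "descends \<omega> P (k - n) T B"
      using descends_climbs[OF less.prems(1) asc] step less.prems(2) by (simp_all add: T_def B_def)
    have l: "l \<in> N" using step less.prems(2) by (simp add: l_def)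
    have "fire a l T = alt_fire a m j i z" by (simp add: n alt_fire_Suc T_def l_def del: alt_fire.simps)
    also have "\<dots> = alt_fire a m i j z" using alt_fire_eq[OF False b] by simp
    also have "\<dots> = T" using n less.prems(3) by (simp add: T_def fire_zero)
    finally have "T l = 0" by (rule fire_fixed)
    moreover have "k - n < k" using d(1) n step by simp
    ultimately have "t l <# B = B" using less.IH[OF _ d(2) l] by blast
    moreover have "t l <# B = alt_mult t m j i A"
      by (simp add: n alt_mult_Suc B_def l_def del: alt_mult.simps)
    moreover have "alt_mult t m j i A = alt_mult t n j i (t i <# A)"
      using braid[OF less.prems(2) step(5) False A] n by (simp add: m_def)
    ultimately have "alt_mult t n j i (t i <# A) = alt_mult t n j i A" by (simp add: B_def)
    then show ?thesis
      using alt_mult_inj A less.prems(2) step(5) l_coset_subset_G[OF A t_closed] by blast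
  qed
qed

text \<open>A point other than the start of its path has a negative value, at the node fired last;
  climbing there shortens both paths, while \<open>\<omega>\<close> has no negative value.\<close>

lemma descends_unique:
  "descends \<omega> P k z A \<Longrightarrow> descends \<omega> P k' z A' \<Longrightarrow> A = A'"
proof (induction k arbitrary: k' z A A')
  case 0
  from 0(1) have z: "z = \<omega>" "A = P" by (cases, simp_all)+
  from 0(2) show ?case
  proof cases
    case (step k z' B i)
    then have "\<omega> i < 0" using z by simp
    then show ?thesis using dominant step by force
  qed (simp add: z)
next
  case (Suc k)
  from Suc.prems(1) obtain i where i: "i \<in> N" "z i < 0"
    by cases auto
  have "descends \<omega> P k (fire a i z) (t i <# A)"
    using descends_climb[OF Suc.prems(1) i] by simp
  moreover have "descends \<omega> P (k' - 1) (fire a i z) (t i <# A')"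
    using descends_climb[OF Suc.prems(2) i] by simp
  ultimately have "t i <# A = t i <# A'" by (rule Suc.IH)
  then show ?case
    by (rule l_coset_inj[OF t_closed[OF i(1)] t_square[OF i(1)] descends_subset[OF Suc.prems(1)]
          descends_subset[OF Suc.prems(2)]])
qed

lemma descends_fire:
  assumes "descends \<omega> P k z A" "i \<in> N"
  shows "\<exists>k'. descends \<omega> P k' (fire a i z) (t i <# A)"
proof -
  consider "z i < 0" | "z i = 0" | "0 < z i" by force
  then show ?thesis
  proof cases
    case 1
    then show ?thesis using descends_climb assms by blast
  next
    case 2
    then show ?thesis using descends_fixed[OF assms] assms(1) by (auto simp: fire_zero)
  next
    case 3
    then show ?thesis using step assms by blast
  qed
qed

lemma descends_act:
  assumes "set w \<subseteq> N"
  shows "\<exists>k. descends \<omega> P k (act w \<omega>) (val w <# P)"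
  using assms
proof (induction w)
  case Nil
  then show ?case using start by (auto simp: lcos_mult_one P_subset)
next
  case (Cons i w)
  then obtain k where "descends \<omega> P k (act w \<omega>) (val w <# P)" by auto
  from descends_fire[OF this, of i] Cons.prems show ?case
    by (simp add: lcos_m_assoc P_subset)
qed

theorem same_coset:
  assumes "set u \<subseteq> N" "set w \<subseteq> N" "act u \<omega> = act w \<omega>"
  shows "val u <# P = val w <# P"
proof -
  obtain k k' where "descends \<omega> P k (act u \<omega>) (val u <# P)"
    "descends \<omega> P k' (act w \<omega>) (val w <# P)"
    using descends_act[OF assms(1)] descends_act[OF assms(2)] by blast
  then show ?thesis using descends_unique unfolding assms(3) by blast
qed

lemma descends_invariant:
  assumes "\<omega> \<in> S" "\<And>z i. z \<in> S \<Longrightarrow> i \<in> N \<Longrightarrow> 0 < z i \<Longrightarrow> fire a i z \<in> S"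
  shows "descends \<omega> P k z A \<Longrightarrow> z \<in> S"
  by (induction rule: descends.induct) (simp_all add: assms)

text \<open>Every point of the orbit is reached by a descending path, so closure under descending
  firings is enough.\<close>

lemma act_invariant:
  assumes "\<omega> \<in> S" "\<And>z i. z \<in> S \<Longrightarrow> i \<in> N \<Longrightarrow> 0 < z i \<Longrightarrow> fire a i z \<in> S"
    and "set w \<subseteq> N"
  shows "act w \<omega> \<in> S"
  using descends_act[OF assms(3)] descends_invariant[OF assms(1,2)] by blast

end

section \<open>Maximal parabolic subgroups as stabilisers of fundamental weights\<close>

locale maximal_parabolic = coxeter_action +
  fixes j :: nat and \<omega> :: "nat \<Rightarrow> 'c"
  assumes j: "j \<in> N" and \<omega>_j: "0 < \<omega> j" and \<omega>_other: "i \<in> N - {j} \<Longrightarrow> \<omega> i = 0"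
begin

definition P :: "'a set" where "P = generate G (t ` (N - {j}))"

lemma P_subgroup: "subgroup P G"
proof -
  have "t ` (N - {j}) \<subseteq> carrier G" by auto
  then show ?thesis unfolding P_def by (rule generate_is_subgroup)
qed

sublocale coset_game G N t M a \<rho> \<omega> P
proof
  show "P \<subseteq> carrier G" using P_subgroup by (rule subgroup.subset)
next
  fix i assume i: "i \<in> N"
  show "0 \<le> \<omega> i" using i \<omega>_j \<omega>_other[of i] by (cases "i = j") auto
  assume "\<omega> i = 0"
  with i have "i \<in> N - {j}" using \<omega>_j by auto
  then show "t i <# P = P" using parabolic_absorb[of "N - {j}" "[i]"] by (simp add: P_def)
qed

lemma \<rho>_P: "g \<in> P \<Longrightarrow> \<rho> g \<omega> = \<omega>"
proof -
  assume "g \<in> P"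
  then obtain w where w: "set w \<subseteq> N - {j}" "val w = g"
    using generate_val[of "N - {j}" g] by (auto simp: P_def)
  then have "\<omega> i = 0" if "i \<in> set w" for i using that \<omega>_other by blast
  then have "act w \<omega> = \<omega>" by (rule act_fixed)
  moreover have "\<rho> g = act w" using w \<rho>_val[of w] by auto
  ultimately show ?thesis by simp
qed

lemma P_proper: "P \<noteq> carrier G"
proof
  assume "P = carrier G"
  then have "\<rho> (t j) \<omega> = \<omega>" using \<rho>_P j by simp
  then have "fire a j \<omega> j = \<omega> j" using \<rho>_t j by simp
  then show False using \<omega>_j by simp
qed

lemma conjugate_in_refl: "conjugate_in G P P"
  unfolding conjugate_in_def
  by (rule bexI[of _ \<one>]) (simp_all add: lcos_mult_one coset_mult_one P_subset)

lemma reached_fire: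
  assumes "reached a (N - {j}) \<omega> x (fire a i z)" "i \<in> N - {j}"
  shows "reached a (N - {j}) \<omega> x z"
proof -
  obtain p q where pq: "set p \<subseteq> N - {j}" "set q \<subseteq> N - {j}" "fire a i z = act (p @ x @ q @ rev x) \<omega>"
    using assms(1) by (auto simp: reached_def)
  have "z = fire a i (fire a i z)" by simp
  also note pq(3)
  finally have "z = act ((i # p) @ x @ q @ rev x) \<omega>" by simp
  then show ?thesis using assms(2) pq(1,2) unfolding reached_def
    by (intro exI[of _ "i # p"] exI[of _ q]) simp
qed

text \<open>\<open>same_coset\<close> turns the equality of points
  \<open>w \<omega> = p x q x^-1 \<omega>\<close> into membership of \<open>w\<close> in
  \<open>P x P x^-1 P\<close>, whose middle factor is the conjugate of \<open>P\<close> by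
  \<open>x\<close>.\<close>

lemma product_of_reached:
  assumes x: "set x \<subseteq> N" and all: "\<And>w. set w \<subseteq> N \<Longrightarrow> reached a (N - {j}) \<omega> x (act w \<omega>)"
  shows "product_of_three_conjugates G P"
proof -
  define X where "X = val x"
  have X: "X \<in> carrier G" "val (rev x) = inv X" using x by (simp_all add: X_def val_rev)
  define Q where "Q = (X <# P) #> inv X"
  have "conjugate_in G P Q" using X by (auto simp: conjugate_in_def Q_def)
  moreover have "(P <#> Q) <#> P = carrier G"
  proof
    show "(P <#> Q) <#> P \<subseteq> carrier G"
      using P_subset X by (simp add: Q_def set_mult_closed l_coset_subset_G r_coset_subset_G)
    show "carrier G \<subseteq> (P <#> Q) <#> P"
    proof
      fix g assume "g \<in> carrier G"
      then obtain w where w: "set w \<subseteq> N" "val w = g" using carrier_val by blast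
      from all[OF w(1)] obtain p q where pq: "set p \<subseteq> N - {j}" "set q \<subseteq> N - {j}"
        "act w \<omega> = act (p @ x @ q @ rev x) \<omega>"
        by (auto simp: reached_def)
      then have pq': "set p \<subseteq> N" "set q \<subseteq> N" by auto
      have "val w <# P = val (p @ x @ q @ rev x) <# P"
        by (rule same_coset[OF w(1) _ pq(3)]) (use pq' x in simp)
      moreover have "val (p @ x @ q @ rev x) = val p \<otimes> (X \<otimes> val q \<otimes> inv X)"
        using pq' x X by (simp add: X_def m_assoc)
      moreover have "g \<in> g <# P"
        using \<open>g \<in> carrier G\<close> subgroup.one_closed[OF P_subgroup] by (force simp: l_coset_def)
      ultimately have "g \<in> (val p \<otimes> (X \<otimes> val q \<otimes> inv X)) <# P" using w(2) by simp
      then obtain h where h: "h \<in> P" "g = val p \<otimes> (X \<otimes> val q \<otimes> inv X) \<otimes> h"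
        by (auto simp: l_coset_def)
      have "val p \<in> P" "val q \<in> P" using val_generate[of "N - {j}"] pq by (auto simp: P_def)
      then have "X \<otimes> val q \<otimes> inv X \<in> Q" by (auto simp: Q_def l_coset_def r_coset_def)
      with \<open>val p \<in> P\<close> have "val p \<otimes> (X \<otimes> val q \<otimes> inv X) \<in> P <#> Q"
        by (auto simp: set_mult_def)
      with h show "g \<in> (P <#> Q) <#> P" unfolding set_mult_def[of G "P <#> Q"] by blast
    qed
  qed
  ultimately show ?thesis unfolding product_of_three_conjugates_def using conjugate_in_refl by blast
qed

text \<open>
  Only the orbit points that are dominant for the parabolic need a word: every other point is
  moved towards \<open>\<omega>\<close> by an element of the parabolic.
\<close>

theorem product_of_dominant:
  assumes "set x \<subseteq> N" and S: "\<omega> \<in> S" "\<And>z i. z \<in> S \<Longrightarrow> i \<in> N \<Longrightarrow> 0 < z i \<Longrightarrow> fire a i z \<in> S"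
    and dom: "\<And>z. z \<in> S \<Longrightarrow> (\<And>i. i \<in> N - {j} \<Longrightarrow> 0 \<le> z i) \<Longrightarrow> reached a (N - {j}) \<omega> x z"
  shows "product_of_three_conjugates G P"
proof (rule product_of_reached[OF assms(1)])
  fix w assume w: "set w \<subseteq> N"
  have "reached a (N - {j}) \<omega> x z" if "descends \<omega> P k z A" for k z A
    using that
  proof (induction k arbitrary: z A rule: less_induct)
    case (less k)
    show ?case
    proof (cases "\<forall>i\<in>N - {j}. 0 \<le> z i")
      case True
      then show ?thesis
        using dom descends_invariant[OF S less.prems] by blast
    next
      case False
      then obtain i where i: "i \<in> N - {j}" "z i < 0" by force
      then have "0 < k \<and> descends \<omega> P (k - 1) (fire a i z) (t i <# A)"
        using descends_climb[OF less.prems] by blast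
      then have "reached a (N - {j}) \<omega> x (fire a i z)" using less.IH by (meson diff_less zero_less_one)
      then show ?thesis using reached_fire i by blast
    qed
  qed
  then show "reached a (N - {j}) \<omega> x (act w \<omega>)"
    using descends_act[OF w] by blast
qed

text \<open>
  If \<open>G = P x P x\<^sup>-\<^sup>1 P\<close>, then any two points \<open>v\<close> and \<open>z\<close> of the orbit of \<open>\<omega>\<close> have a common
  neighbour in the orbital graph of \<open>x\<close>; taking \<open>z = - \<omega>\<close> shows that neighbours are orthogonal.
\<close>

theorem orthogonal_neighbour:
  fixes B :: "(nat \<Rightarrow> 'c) \<Rightarrow> (nat \<Rightarrow> 'c) \<Rightarrow> 'c"
  assumes inv: "\<And>i c d. i \<in> N \<Longrightarrow> B (fire a i c) (fire a i d) = B c d"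
    and sym: "\<And>c d. B c d = B d c" and neg: "\<And>c d. B (\<lambda>l. - c l) d = - B c d"
    and x: "x \<in> carrier G"
    and cover: "\<And>g. g \<in> carrier G \<Longrightarrow> \<exists>p\<in>P. \<exists>q\<in>P. \<exists>h\<in>P. g = p \<otimes> x \<otimes> q \<otimes> inv x \<otimes> h"
    and w0: "set w0 \<subseteq> N" "act w0 \<omega> = (\<lambda>l. - \<omega> l)" and w: "set w \<subseteq> N"
  obtains u where "set u \<subseteq> N" "B \<omega> (act u \<omega>) = 0" "B (act w \<omega>) (act u \<omega>) = 0"
proof -
  have B_act: "B (act v c) (act v d) = B c d" if "set v \<subseteq> N" for v c d
    using that by (induction v) (simp_all add: inv)
  have B_\<rho>: "B (\<rho> g c) (\<rho> g d) = B c d" if g: "g \<in> carrier G" for g c d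
  proof -
    obtain v where "set v \<subseteq> N" "val v = g" using carrier_val[OF g] by blast
    then show ?thesis using B_act[of v] \<rho>_val[of v] by simp
  qed
  have \<rho>_inv: "\<rho> (inv x) (\<rho> x c) = c" "\<rho> x (\<rho> (inv x) c) = c" for c
    using \<rho>_mult[of "inv x" x] \<rho>_mult[of x "inv x"] x by (simp_all add: fun_eq_iff)
  \<comment> \<open>The common neighbour is \<open>p x \<omega>\<close>. Writing
    \<open>v = p x q x^-1 h\<close> and cancelling \<open>p\<close>, then \<open>q\<close>, then
    \<open>x^-1\<close> by invariance, its pairing with \<open>v \<omega>\<close> becomes that of
    \<open>\<omega>\<close> with \<open>x \<omega>\<close>.\<close>
  have key: "\<exists>p\<in>P. B \<omega> (\<rho> p (\<rho> x \<omega>)) = B \<omega> (\<rho> x \<omega>) \<and> B (act v \<omega>) (\<rho> p (\<rho> x \<omega>)) = B \<omega> (\<rho> x \<omega>)"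
    if v: "set v \<subseteq> N" for v
  proof -
    obtain p q h where g: "p \<in> P" "q \<in> P" "h \<in> P" "val v = p \<otimes> x \<otimes> q \<otimes> inv x \<otimes> h"
      using cover[of "val v"] v by auto
    then have c: "p \<in> carrier G" "q \<in> carrier G" "h \<in> carrier G" using P_subset by auto
    have "act v \<omega> = \<rho> p (\<rho> x (\<rho> q (\<rho> (inv x) \<omega>)))"
      using \<rho>_val[OF v, symmetric] g c x by (simp add: \<rho>_mult \<rho>_P)
    then have "B (act v \<omega>) (\<rho> p (\<rho> x \<omega>)) = B (\<rho> q (\<rho> (inv x) \<omega>)) (\<rho> q \<omega>)"
      using B_\<rho> c x g by (simp add: \<rho>_P)
    also have "\<dots> = B (\<rho> x (\<rho> (inv x) \<omega>)) (\<rho> x \<omega>)" using B_\<rho> c x by simp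
    also have "\<dots> = B \<omega> (\<rho> x \<omega>)" by (simp add: \<rho>_inv)
    finally have "B (act v \<omega>) (\<rho> p (\<rho> x \<omega>)) = B \<omega> (\<rho> x \<omega>)" .
    moreover have "B \<omega> (\<rho> p (\<rho> x \<omega>)) = B \<omega> (\<rho> x \<omega>)"
      using B_\<rho>[OF c(1), of \<omega> "\<rho> x \<omega>"] g(1) by (simp add: \<rho>_P)
    ultimately show ?thesis using g(1) by blast
  qed
  \<comment> \<open>For \<open>- \<omega>\<close> the same number has to equal its own
    negative.\<close>
  from key[OF w0(1)] have zero: "B \<omega> (\<rho> x \<omega>) = 0"
    by (auto simp: w0(2) neg)
  from key[OF w] obtain p where p: "p \<in> P" "B \<omega> (\<rho> p (\<rho> x \<omega>)) = 0" "B (act w \<omega>) (\<rho> p (\<rho> x \<omega>)) = 0"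
    using zero by auto
  have "p \<otimes> x \<in> carrier G" using p(1) x P_subset by auto
  then obtain u where u: "set u \<subseteq> N" "val u = p \<otimes> x" using carrier_val by blast
  have "act u = \<rho> (p \<otimes> x)" using \<rho>_val[OF u(1)] u(2) by simp
  also have "\<dots> = \<rho> p \<circ> \<rho> x" using p(1) x P_subset by (intro \<rho>_mult) auto
  finally have "act u \<omega> = \<rho> p (\<rho> x \<omega>)" by simp
  then show thesis using that u p by simp
qed

end

section \<open>Criteria for Coxeter groups of a given type\<close>

text \<open>With the three conjugating elements pulled together the group becomes
  \<open>W y W z W\<close>. As it contains the identity, \<open>z\<close> may be replaced by
  \<open>y^-1\<close>; enlarging \<open>W\<close> to a maximal standard parabolic preserves the
  covering.\<close>

lemma (in group) three_conjugates_double_coset: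
  assumes s: "s ` X \<subseteq> carrier G" and gen: "generate G (s ` X) = carrier G"
    and I: "I \<subseteq> X" and P: "conjugate_in G (generate G (s ` I)) P" "P \<noteq> carrier G"
    and prod: "product_of_three_conjugates G P"
  shows "\<exists>j\<in>X. \<exists>x\<in>carrier G. \<forall>g\<in>carrier G.
    \<exists>p\<in>generate G (s ` (X - {j})). \<exists>q\<in>generate G (s ` (X - {j})). \<exists>h\<in>generate G (s ` (X - {j})).
      g = p \<otimes> x \<otimes> q \<otimes> inv x \<otimes> h"
proof -
  define W where "W = generate G (s ` I)"
  have "s ` I \<subseteq> carrier G" using I s by blast
  then interpret W: subgroup W G unfolding W_def by (rule generate_is_subgroup)
  have cancel: "inv b \<otimes> (b \<otimes> y) = y" "b \<otimes> (inv b \<otimes> y) = y"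
    if "b \<in> carrier G" "y \<in> carrier G" for b y
    using that by (simp_all flip: m_assoc)
  have conj: "\<exists>b\<in>carrier G. \<forall>z\<in>Q. \<exists>w\<in>W. z = b \<otimes> w \<otimes> inv b" if Q: "conjugate_in G P Q" for Q
  proof -
    obtain c where c: "c \<in> carrier G" "P = (c <# W) #> inv c"
      using P(1) unfolding conjugate_in_def W_def by blast
    obtain d where d: "d \<in> carrier G" "Q = (d <# P) #> inv d"
      using Q unfolding conjugate_in_def by blast
    have "\<exists>w\<in>W. z = (d \<otimes> c) \<otimes> w \<otimes> inv (d \<otimes> c)" if z: "z \<in> Q" for z
    proof -
      obtain w where w: "w \<in> W" "z = d \<otimes> (c \<otimes> w \<otimes> inv c) \<otimes> inv d"
        using z unfolding d(2) c(2) by (auto simp: l_coset_def r_coset_def)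
      have "w \<in> carrier G" using w(1) by (rule W.mem_carrier)
      with w(2) have "z = (d \<otimes> c) \<otimes> w \<otimes> inv (d \<otimes> c)"
        using c(1) d(1) by (simp add: inv_mult_group m_assoc)
      with w(1) show ?thesis by blast
    qed
    then show ?thesis using c d by blast
  qed
  \<comment> \<open>If no generator were omitted, \<open>P\<close> would be a conjugate of the whole
    group.\<close>
  have "\<exists>j\<in>X. I \<subseteq> X - {j}"
  proof (rule ccontr)
    assume "\<not> ?thesis"
    then have "I = X" using I by blast
    then have "W = carrier G" using gen W_def by simp
    moreover obtain c where c: "c \<in> carrier G" "P = (c <# W) #> inv c"
      using P(1) unfolding conjugate_in_def W_def by blast
    moreover have "z \<in> P" if "z \<in> carrier G" for z
    proof -
      have "z = c \<otimes> (inv c \<otimes> z \<otimes> c) \<otimes> inv c"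
        using that c by (simp add: m_assoc cancel)
      moreover have "inv c \<otimes> z \<otimes> c \<in> W" using that c \<open>W = carrier G\<close> by simp
      ultimately show ?thesis unfolding c(2) l_coset_def r_coset_def by blast
    qed
    moreover have "P \<subseteq> carrier G"
      using c W.subset by (simp add: l_coset_subset_G r_coset_subset_G)
    ultimately show False using P(2) by blast
  qed
  then obtain j where j: "j \<in> X" "I \<subseteq> X - {j}" by blast
  have sub: "W \<subseteq> generate G (s ` (X - {j}))"
    unfolding W_def by (rule mono_generate) (use j in blast)
  obtain P1 P2 P3 where P123: "conjugate_in G P P1" "conjugate_in G P P2" "conjugate_in G P P3"
    "(P1 <#> P2) <#> P3 = carrier G"
    using prod by (auto simp: product_of_three_conjugates_def)
  obtain b1 where b1: "b1 \<in> carrier G" "\<And>z. z \<in> P1 \<Longrightarrow> \<exists>w\<in>W. z = b1 \<otimes> w \<otimes> inv b1"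
    using conj[OF P123(1)] by blast
  obtain b2 where b2: "b2 \<in> carrier G" "\<And>z. z \<in> P2 \<Longrightarrow> \<exists>w\<in>W. z = b2 \<otimes> w \<otimes> inv b2"
    using conj[OF P123(2)] by blast
  obtain b3 where b3: "b3 \<in> carrier G" "\<And>z. z \<in> P3 \<Longrightarrow> \<exists>w\<in>W. z = b3 \<otimes> w \<otimes> inv b3"
    using conj[OF P123(3)] by blast
  define y z where "y = inv b1 \<otimes> b2" and "z = inv b2 \<otimes> b3"
  have yz: "y \<in> carrier G" "z \<in> carrier G" using b1 b2 b3 by (simp_all add: y_def z_def)
  have decomp: "\<exists>w1\<in>W. \<exists>w2\<in>W. \<exists>w3\<in>W. g = w1 \<otimes> y \<otimes> w2 \<otimes> z \<otimes> w3" if g: "g \<in> carrier G" for g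
  proof -
    have "b1 \<otimes> g \<otimes> inv b3 \<in> (P1 <#> P2) <#> P3" using P123(4) b1 b3 g by simp
    then obtain x1 x2 x3 where x: "x1 \<in> P1" "x2 \<in> P2" "x3 \<in> P3" "b1 \<otimes> g \<otimes> inv b3 = x1 \<otimes> x2 \<otimes> x3"
      unfolding set_mult_def by blast
    obtain w1 w2 w3 where w: "w1 \<in> W" "x1 = b1 \<otimes> w1 \<otimes> inv b1" "w2 \<in> W" "x2 = b2 \<otimes> w2 \<otimes> inv b2"
      "w3 \<in> W" "x3 = b3 \<otimes> w3 \<otimes> inv b3"
      using b1(2)[OF x(1)] b2(2)[OF x(2)] b3(2)[OF x(3)] by blast
    then have wc: "w1 \<in> carrier G" "w2 \<in> carrier G" "w3 \<in> carrier G" by auto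
    have "g = inv b1 \<otimes> (b1 \<otimes> g \<otimes> inv b3) \<otimes> b3"
      using g b1(1) b3(1) by (simp add: m_assoc cancel)
    also have "\<dots> = w1 \<otimes> y \<otimes> w2 \<otimes> z \<otimes> w3"
      unfolding x(4) w y_def z_def using wc b1(1) b2(1) b3(1) by (simp add: m_assoc cancel)
    finally show ?thesis using w by blast
  qed
  \<comment> \<open>Decomposing the identity puts \<open>z\<close> into the double coset
    \<open>W y^-1 W\<close>.\<close>
  obtain v1 v2 v3 where v: "v1 \<in> W" "v2 \<in> W" "v3 \<in> W" "\<one> = v1 \<otimes> y \<otimes> v2 \<otimes> z \<otimes> v3"
    using decomp[of \<one>] by blast
  then have vc: "v1 \<in> carrier G" "v2 \<in> carrier G" "v3 \<in> carrier G" by auto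
  have z: "z = inv v2 \<otimes> inv y \<otimes> inv v1 \<otimes> inv v3"
  proof -
    have "(v1 \<otimes> y \<otimes> v2) \<otimes> (z \<otimes> v3) = \<one>" using v(4)[symmetric] vc yz by (simp add: m_assoc)
    then have "inv (z \<otimes> v3) = v1 \<otimes> y \<otimes> v2"
      using vc yz by (intro inv_equality) simp_all
    then have "inv (v1 \<otimes> y \<otimes> v2) \<otimes> inv v3 = z \<otimes> v3 \<otimes> inv v3"
      using vc yz inv_inv[of "z \<otimes> v3"] by simp
    also have "\<dots> = z" using vc yz by (simp add: m_assoc)
    finally show ?thesis using vc yz by (simp add: inv_mult_group m_assoc)
  qed
  have "\<exists>p\<in>W. \<exists>q\<in>W. \<exists>h\<in>W. g = p \<otimes> y \<otimes> q \<otimes> inv y \<otimes> h" if g: "g \<in> carrier G" for g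
  proof -
    obtain w1 w2 w3 where w: "w1 \<in> W" "w2 \<in> W" "w3 \<in> W" "g = w1 \<otimes> y \<otimes> w2 \<otimes> z \<otimes> w3"
      using decomp[OF g] by blast
    then have wc: "w1 \<in> carrier G" "w2 \<in> carrier G" "w3 \<in> carrier G" by auto
    have "g = w1 \<otimes> y \<otimes> (w2 \<otimes> inv v2) \<otimes> inv y \<otimes> (inv v1 \<otimes> inv v3 \<otimes> w3)"
      using w(4) z wc vc yz by (simp add: m_assoc)
    moreover have "w2 \<otimes> inv v2 \<in> W" "inv v1 \<otimes> inv v3 \<otimes> w3 \<in> W" using w v by simp_all
    ultimately show ?thesis using w(1) by blast
  qed
  then show ?thesis using j(1) yz(1) sub by blast
qed

text \<open>\<open>q\<close> numbers the generators as in the standard graph. Since the last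
  property is an equivalence, a missing edge forces the matrix entry below 3, hence to be 2.\<close>

lemma has_type_relabel:
  assumes m: "coxeter_matrix n m" and "has_type n m T"
  obtains p q where "bij_betw p {1..n} {1..type_rank T}" "bij_betw q {1..type_rank T} {1..n}"
    and "\<And>i. i \<in> {1..n} \<Longrightarrow> q (p i) = i" "\<And>i. i \<in> {1..type_rank T} \<Longrightarrow> p (q i) = i"
    and "\<And>i j k. i \<in> {1..type_rank T} \<Longrightarrow> j \<in> {1..type_rank T} \<Longrightarrow> i \<noteq> j \<Longrightarrow>
      ({i, j}, k) \<in> type_graph T \<longleftrightarrow> 3 \<le> k \<and> m (q i) (q j) = k"
proof -
  obtain p where p: "bij_betw p {1..n} {1..type_rank T}"
    and graph: "(\<lambda>(e, k). (p ` e, k)) ` coxeter_graph n m = type_graph T"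
    using assms(2) by (auto simp: has_type_def)
  define q where "q = the_inv_into {1..n} p"
  have q: "bij_betw q {1..type_rank T} {1..n}" unfolding q_def by (rule bij_betw_the_inv_into[OF p])
  have qp: "q (p i) = i" if "i \<in> {1..n}" for i
    unfolding q_def using p that by (intro the_inv_into_f_f) (auto simp: bij_betw_def)
  have pq: "p (q i) = i" if "i \<in> {1..type_rank T}" for i
    unfolding q_def using p that by (intro f_the_inv_into_f) (auto simp: bij_betw_def)
  have edge: "({i, j}, k) \<in> type_graph T \<longleftrightarrow> 3 \<le> k \<and> m (q i) (q j) = k"
    if ij: "i \<in> {1..type_rank T}" "j \<in> {1..type_rank T}" "i \<noteq> j" for i j k
  proof
    have qij: "q i \<in> {1..n}" "q j \<in> {1..n}" using q ij by (auto simp: bij_betw_def)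
    assume "3 \<le> k \<and> m (q i) (q j) = k"
    moreover have "q i \<noteq> q j" using ij pq by metis
    ultimately have "({q i, q j}, k) \<in> coxeter_graph n m" using qij unfolding coxeter_graph_def by blast
    then have "(p ` {q i, q j}, k) \<in> type_graph T" unfolding graph[symmetric] by force
    then show "({i, j}, k) \<in> type_graph T" using pq ij by simp
  next
    assume "({i, j}, k) \<in> type_graph T"
    then obtain u v where uv: "u \<in> {1..n}" "v \<in> {1..n}" "3 \<le> m u v" "k = m u v" "{i, j} = p ` {u, v}"
      unfolding graph[symmetric] coxeter_graph_def by auto
    then have "i = p u \<and> j = p v \<or> i = p v \<and> j = p u" by (auto simp: doubleton_eq_iff)
    then have "q i = u \<and> q j = v \<or> q i = v \<and> q j = u" using qp uv(1,2) by auto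
    moreover have "m u v = m v u" using m uv(1,2) unfolding coxeter_matrix_def by blast
    ultimately show "3 \<le> k \<and> m (q i) (q j) = k" using uv by auto
  qed
  show thesis using that p q qp pq edge by blast
qed

section \<open>The reflection action of a Coxeter group of a given type\<close>

lemma (in group) word_value_replicate:
  assumes "x \<in> carrier G" "y \<in> carrier G" "s i = x" "s j = y"
  shows "word_value G s (concat (replicate k [(i, True), (j, True)])) = (x \<otimes> y) [^] (k::nat)"
proof (induction k)
  case (Suc k)
  then show ?case using assms nat_pow_Suc2[of "x \<otimes> y" k] by (simp add: m_assoc)
qed simp

lemma coxeter_relation:
  assumes "finite_coxeter_group C n s m" "i \<in> {1..n}" "j \<in> {1..n}"
  shows "(s i \<otimes>\<^bsub>C\<^esub> s j) [^]\<^bsub>C\<^esub> m i j = \<one>\<^bsub>C\<^esub>"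
proof -
  have pres: "has_presentation C {1..n} s (coxeter_relators n m)"
    using assms(1) by (simp add: finite_coxeter_group_def)
  then interpret group C by (simp add: has_presentation_def)
  define r where "r = concat (replicate (m i j) [(i, True), (j, True)])"
  have "r \<in> coxeter_relators n m" using assms(2,3) by (auto simp: coxeter_relators_def r_def)
  then have "presented_eq {1..n} (coxeter_relators n m) r []" by (rule presented_eq.relator)
  moreover have "concat (replicate k [(i, True), (j, True)]) \<in> words {1..n}" for k
    using assms(2,3) by (induction k) (auto simp: words_def)
  then have "r \<in> words {1..n}" "[] \<in> words {1..n}" by (auto simp: words_def r_def)
  ultimately have "word_value C s r = word_value C s []"
    using pres unfolding has_presentation_def by blast
  moreover have "s i \<in> carrier C" "s j \<in> carrier C"
    using pres assms(2,3) by (auto simp: has_presentation_def)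
  ultimately show ?thesis by (simp add: r_def word_value_replicate)
qed

text \<open>Pairs with \<open>i < j\<close> suffice by \<open>bond_sym\<close>. The labels listed
  are the edge labels for which \<open>bond\<close> has a clause; its clause for 2 is the absence of
  an edge.\<close>

definition bonded :: "nat \<Rightarrow> (nat set \<times> nat) set \<Rightarrow> (nat \<Rightarrow> nat \<Rightarrow> 'r::linordered_idom) \<Rightarrow> bool" where
  "bonded r E a \<longleftrightarrow> (\<forall>i\<in>{1..r}. \<forall>j\<in>{1..r}. i < j \<longrightarrow>
     (\<exists>k\<in>{3, 4, 5}. ({i, j}, k) \<in> E \<and> bond a k i j) \<or>
     (\<forall>k. ({i, j}, k) \<notin> E) \<and> a i j = 0 \<and> a j i = 0)"

text \<open>By \<open>fire_order\<close> the firings satisfy the Coxeter relations, so the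
  presentation lets the group act by them.\<close>

lemma coxeter_action_of_type:
  fixes a :: "nat \<Rightarrow> nat \<Rightarrow> 'r::linordered_idom"
  assumes C: "finite_coxeter_group C n s m" and T: "has_type n m T"
    and a: "bonded (type_rank T) (type_graph T) a" and pos: "0 < type_rank T"
  obtains q M \<rho> where "bij_betw q {1..type_rank T} {1..n}"
    and "coxeter_action C {1..type_rank T} (s \<circ> q) M a \<rho>"
proof -
  let ?N = "{1..type_rank T}"
  have cm: "coxeter_matrix n m" and pres: "has_presentation C {1..n} s (coxeter_relators n m)"
    using C by (simp_all add: finite_coxeter_group_def)
  interpret group C using pres by (simp add: has_presentation_def)
  obtain p q where p: "bij_betw p {1..n} ?N" and q: "bij_betw q ?N {1..n}"
    and qp: "\<And>i. i \<in> {1..n} \<Longrightarrow> q (p i) = i" and pq: "\<And>i. i \<in> ?N \<Longrightarrow> p (q i) = i"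
    and edge: "\<And>i j k. i \<in> ?N \<Longrightarrow> j \<in> ?N \<Longrightarrow> i \<noteq> j \<Longrightarrow>
      ({i, j}, k) \<in> type_graph T \<longleftrightarrow> 3 \<le> k \<and> m (q i) (q j) = k"
    using has_type_relabel[OF cm T] by blast
  have qN: "q i \<in> {1..n}" if "i \<in> ?N" for i using q that by (auto simp: bij_betw_def)
  have pN: "p i \<in> ?N" if "i \<in> {1..n}" for i using p that by (auto simp: bij_betw_def)
  define M where "M i j = m (q i) (q j)" for i j
  have M2: "M i j = M j i \<and> 2 \<le> M i j" if "i \<in> ?N" "j \<in> ?N" "i \<noteq> j" for i j
  proof -
    have "q i \<noteq> q j" using that pq by metis
    then show ?thesis using cm qN that unfolding coxeter_matrix_def M_def by blast
  qed
  have bond_less: "bond a (M i j) i j" if ij: "i \<in> ?N" "j \<in> ?N" "i < j" for i j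
  proof -
    from a ij consider k where "({i, j}, k) \<in> type_graph T" "bond a k i j"
      | "\<forall>k. ({i, j}, k) \<notin> type_graph T" "a i j = 0" "a j i = 0"
      unfolding bonded_def by blast
    then show ?thesis
    proof cases
      case 1
      then show ?thesis using edge[of i j k] ij by (simp add: M_def)
    next
      case 2
      then have "M i j < 3" using edge[of i j "M i j"] ij by (force simp: M_def)
      then have "M i j = 2" using M2[of i j] ij by simp
      then show ?thesis using 2 by (simp add: bond_def)
    qed
  qed
  have bnd: "bond a (M i j) i j" if "i \<in> ?N" "j \<in> ?N" "i \<noteq> j" for i j
  proof (cases "i < j")
    case False
    then have "bond a (M j i) j i" using bond_less that by simp
    then show ?thesis using M2[OF that] by (simp add: bond_sym)
  qed (use bond_less that in simp)
  have sq: "fire a (p i) \<circ> fire a (p i) = id" for i by (simp add: fun_eq_iff)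
  have rels: "word_act (\<lambda>i. fire a (p i)) r = id" if rel: "r \<in> coxeter_relators n m" for r
  proof -
    obtain i j where ij: "i \<in> {1..n}" "j \<in> {1..n}"
      and r: "r = concat (replicate (m i j) [(i, True), (j, True)])"
      using rel unfolding coxeter_relators_def by blast
    have "(fire a (p i) \<circ> fire a (p j)) ^^ m i j = id"
    proof (cases "i = j")
      case True
      then have "m i j = 1" using cm ij by (auto simp: coxeter_matrix_def)
      then show ?thesis using True by (simp add: fun_eq_iff)
    next
      case False
      then have "p i \<noteq> p j" using qp ij by metis
      moreover have "bond a (m i j) (p i) (p j)"
        using bnd[of "p i" "p j"] pN ij qp \<open>p i \<noteq> p j\<close> by (simp add: M_def)
      ultimately show ?thesis by (rule fire_order)
    qed
    then show ?thesis by (simp add: r word_act_replicate)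
  qed
  obtain \<rho> where \<rho>: "\<And>i. i \<in> {1..n} \<Longrightarrow> \<rho> (s i) = fire a (p i)"
    "\<And>g h. g \<in> carrier C \<Longrightarrow> h \<in> carrier C \<Longrightarrow> \<rho> (g \<otimes>\<^bsub>C\<^esub> h) = \<rho> g \<circ> \<rho> h"
    by (rule presentation_action[OF pres, of "\<lambda>i. fire a (p i)"]) (rule sq, erule rels, rule that)
  have sc: "s i \<in> carrier C" if "i \<in> {1..n}" for i
    using pres that by (auto simp: has_presentation_def)
  have "coxeter_action C ?N (s \<circ> q) M a \<rho>"
  proof
    show "?N \<noteq> {}" using pos by simp
    show "generate C ((s \<circ> q) ` ?N) = carrier C"
      using pres q unfolding image_comp[symmetric] bij_betw_def by (simp add: has_presentation_def)
    fix i assume i: "i \<in> ?N"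
    show "(s \<circ> q) i \<in> carrier C" using sc qN i by simp
    show "(s \<circ> q) i \<otimes>\<^bsub>C\<^esub> (s \<circ> q) i = \<one>\<^bsub>C\<^esub>"
    proof -
      have "m (q i) (q i) = 1" using cm qN[OF i] by (auto simp: coxeter_matrix_def)
      then show ?thesis using coxeter_relation[OF C qN[OF i] qN[OF i]] sc[OF qN[OF i]] by simp
    qed
    show "\<rho> ((s \<circ> q) i) = fire a i" using \<rho>(1)[OF qN[OF i]] pq[OF i] by simp
    fix j assume j: "j \<in> ?N" "i \<noteq> j"
    show "((s \<circ> q) i \<otimes>\<^bsub>C\<^esub> (s \<circ> q) j) [^]\<^bsub>C\<^esub> M i j = \<one>\<^bsub>C\<^esub>"
      using coxeter_relation[OF C qN[OF i] qN[OF j(1)]] by (simp add: M_def)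
    show "bond a (M i j) i j" using bnd i j by simp
  qed (use \<rho> in blast)
  then show thesis using that q by blast
qed

theorem three_conjugates_criterion:
  fixes a :: "nat \<Rightarrow> nat \<Rightarrow> 'r::linordered_idom"
  assumes C: "finite_coxeter_group C n s m" and T: "has_type n m T"
    and a: "bonded (type_rank T) (type_graph T) a"
    and j: "j \<in> {1..type_rank T}" and \<omega>: "0 < \<omega> j" "\<And>i. i \<in> {1..type_rank T} - {j} \<Longrightarrow> \<omega> i = 0"
    and x: "set x \<subseteq> {1..type_rank T}"
    and S: "\<omega> \<in> S" "\<And>z i. z \<in> S \<Longrightarrow> i \<in> {1..type_rank T} \<Longrightarrow> 0 < z i \<Longrightarrow> fire a i z \<in> S"
    and dom: "\<And>z. z \<in> S \<Longrightarrow> (\<And>i. i \<in> {1..type_rank T} - {j} \<Longrightarrow> 0 \<le> z i) \<Longrightarrow>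
      reached a ({1..type_rank T} - {j}) \<omega> x z"
  shows "\<exists>P. parabolic_subgroup C n s P \<and> P \<noteq> carrier C \<and> product_of_three_conjugates C P"
proof -
  have "0 < type_rank T" using j by simp
  then obtain q M \<rho> where q: "bij_betw q {1..type_rank T} {1..n}"
    and act: "coxeter_action C {1..type_rank T} (s \<circ> q) M a \<rho>"
    using coxeter_action_of_type[OF C T a] by blast
  interpret maximal_parabolic C "{1..type_rank T}" "s \<circ> q" M a \<rho> j \<omega>
    using act j \<omega> by (intro maximal_parabolic.intro maximal_parabolic_axioms.intro)
  have "P = generate C (s ` (q ` ({1..type_rank T} - {j})))" by (simp only: P_def image_comp)
  moreover have "q ` ({1..type_rank T} - {j}) \<subseteq> {1..n}" using q by (auto simp: bij_betw_def)
  ultimately have "parabolic_subgroup C n s P"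
    using conjugate_in_refl unfolding parabolic_subgroup_def by metis
  then show ?thesis using P_proper product_of_dominant[OF x S dom] by blast
qed

text \<open>One weight per node suffices, because every proper parabolic is conjugate into a maximal
  standard one. \<open>w0\<close> puts the negative of the weight into the orbit, and
  \<open>w\<close> names a point sharing no orthogonal neighbour with it.\<close>

theorem no_three_conjugates_criterion:
  fixes a :: "nat \<Rightarrow> nat \<Rightarrow> 'r::linordered_idom"
  assumes C: "finite_coxeter_group C n s m" and T: "has_type n m T"
    and a: "bonded (type_rank T) (type_graph T) a" and pos: "0 < type_rank T"
    and inv: "\<And>i c d. i \<in> {1..type_rank T} \<Longrightarrow> B (fire a i c) (fire a i d) = B c d"
    and sym: "\<And>c d. B c d = (B d c :: 'r)" and neg: "\<And>c d. B (\<lambda>l. - c l) d = - B c d"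
    and orbit: "\<And>j. j \<in> {1..type_rank T} \<Longrightarrow> \<exists>\<omega> S w0 w. 0 < \<omega> j \<and>
      (\<forall>i\<in>{1..type_rank T} - {j}. \<omega> i = 0) \<and> \<omega> \<in> S \<and>
      (\<forall>z\<in>S. \<forall>i\<in>{1..type_rank T}. 0 < z i \<longrightarrow> fire a i z \<in> S) \<and>
      set w0 \<subseteq> {1..type_rank T} \<and> fires a w0 \<omega> = (\<lambda>l. - \<omega> l) \<and> set w \<subseteq> {1..type_rank T} \<and>
      (\<forall>z\<in>S. B \<omega> z = 0 \<longrightarrow> B (fires a w \<omega>) z \<noteq> 0)"
  shows "\<not> (\<exists>P. parabolic_subgroup C n s P \<and> P \<noteq> carrier C \<and> product_of_three_conjugates C P)"
proof
  assume "\<exists>P. parabolic_subgroup C n s P \<and> P \<noteq> carrier C \<and> product_of_three_conjugates C P"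
  then obtain P I where P: "conjugate_in C (generate C (s ` I)) P" "I \<subseteq> {1..n}" "P \<noteq> carrier C"
    "product_of_three_conjugates C P"
    by (auto simp: parabolic_subgroup_def)
  have pres: "has_presentation C {1..n} s (coxeter_relators n m)"
    using C by (simp add: finite_coxeter_group_def)
  then interpret group C by (simp add: has_presentation_def)
  have gens: "s ` {1..n} \<subseteq> carrier C" "generate C (s ` {1..n}) = carrier C"
    using pres by (simp_all only: has_presentation_def)
  obtain k x where k: "k \<in> {1..n}" "x \<in> carrier C" and cover: "\<And>g. g \<in> carrier C \<Longrightarrow>
      \<exists>p\<in>generate C (s ` ({1..n} - {k})). \<exists>q\<in>generate C (s ` ({1..n} - {k})).
      \<exists>h\<in>generate C (s ` ({1..n} - {k})). g = p \<otimes>\<^bsub>C\<^esub> x \<otimes>\<^bsub>C\<^esub> q \<otimes>\<^bsub>C\<^esub> inv\<^bsub>C\<^esub> x \<otimes>\<^bsub>C\<^esub> h"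
    using three_conjugates_double_coset[OF gens P(2,1,3,4)] by (elim bexE) (rule that, auto)
  obtain q M \<rho> where q: "bij_betw q {1..type_rank T} {1..n}"
    and act: "coxeter_action C {1..type_rank T} (s \<circ> q) M a \<rho>"
    using coxeter_action_of_type[OF C T a pos] by blast
  then obtain j where j: "j \<in> {1..type_rank T}" "q j = k"
    using k(1) by (metis bij_betw_def imageE)
  obtain \<omega> S w0 w where \<omega>: "0 < \<omega> j" "\<forall>i\<in>{1..type_rank T} - {j}. \<omega> i = 0" "\<omega> \<in> S"
      "\<forall>z\<in>S. \<forall>i\<in>{1..type_rank T}. 0 < z i \<longrightarrow> fire a i z \<in> S"
      "set w0 \<subseteq> {1..type_rank T}" "fires a w0 \<omega> = (\<lambda>l. - \<omega> l)" "set w \<subseteq> {1..type_rank T}"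
      "\<forall>z\<in>S. B \<omega> z = 0 \<longrightarrow> B (fires a w \<omega>) z \<noteq> 0"
    using orbit[OF j(1)] by (elim exE conjE) rule
  interpret X: maximal_parabolic C "{1..type_rank T}" "s \<circ> q" M a \<rho> j \<omega>
    using act j \<omega>(1,2) by (intro maximal_parabolic.intro maximal_parabolic_axioms.intro) auto
  have "q ` ({1..type_rank T} - {j}) = {1..n} - {k}"
    using inj_on_image_set_diff[of q "{1..type_rank T}" "{1..type_rank T}" "{j}"] q j
    unfolding bij_betw_def by auto
  then have XP: "X.P = generate C (s ` ({1..n} - {k}))" by (simp only: X.P_def image_comp[symmetric])
  obtain u where u: "set u \<subseteq> {1..type_rank T}" "B \<omega> (fires a u \<omega>) = 0"
      "B (fires a w \<omega>) (fires a u \<omega>) = 0"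
  proof (rule X.orthogonal_neighbour[of B x w0 w])
    show "B (fire a i c) (fire a i d) = B c d" if "i \<in> {1..type_rank T}" for i c d
      using that by (rule inv)
    show "B c d = B d c" for c d by (rule sym)
    show "B (\<lambda>l. - c l) d = - B c d" for c d by (rule neg)
    show "\<exists>p\<in>X.P. \<exists>q\<in>X.P. \<exists>h\<in>X.P. g = p \<otimes>\<^bsub>C\<^esub> x \<otimes>\<^bsub>C\<^esub> q \<otimes>\<^bsub>C\<^esub> inv\<^bsub>C\<^esub> x \<otimes>\<^bsub>C\<^esub> h"
      if "g \<in> carrier C" for g
      unfolding XP using that by (rule cover)
    show "x \<in> carrier C" by (rule k(2))
    show "set w0 \<subseteq> {1..type_rank T}" "fires a w0 \<omega> = (\<lambda>l. - \<omega> l)" "set w \<subseteq> {1..type_rank T}"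
      by (rule \<omega>(5) \<omega>(6) \<omega>(7))+
  qed (rule that)
  moreover have "fires a u \<omega> \<in> S" using X.act_invariant[OF \<omega>(3) _ u(1)] \<omega>(4) by blast
  ultimately show False using \<omega>(8) by blast
qed

section \<open>Computing orbits\<close>

text \<open>
  Row \<open>i\<close> of a table holds the coefficients \<open>a i l\<close> and, on the diagonal, \<open>- 2\<close>, so that firing
  \<open>i\<close> adds a multiple of that row.
\<close>

definition coeff :: "'r::linordered_idom list list \<Rightarrow> nat \<Rightarrow> nat \<Rightarrow> 'r" where
  "coeff A i l = (if i \<in> {1..length A} \<and> l \<in> {1..length A} \<and> i \<noteq> l then A ! (i - 1) ! (l - 1) else 0)"

definition table :: "'r::linordered_idom list list \<Rightarrow> bool" where
  "table A \<longleftrightarrow> (\<forall>i<length A. length (A ! i) = length A \<and> A ! i ! i = - 2)"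

definition add_row :: "'r::linordered_idom list \<Rightarrow> 'r \<Rightarrow> 'r list \<Rightarrow> 'r list" where
  "add_row xs x row = map2 (\<lambda>y k. y + x * k) xs row"

definition fire_list :: "'r::linordered_idom list list \<Rightarrow> nat \<Rightarrow> 'r list \<Rightarrow> 'r list" where
  "fire_list A i xs = add_row xs (xs ! (i - 1)) (A ! (i - 1))"

text \<open>
  Evaluated by rewriting, a right fold over \<open>w\<close> copies unevaluated arguments and takes exponential
  time; the accumulator avoids this.
\<close>

primrec fires_acc :: "'r::linordered_idom list list \<Rightarrow> nat list \<Rightarrow> 'r list \<Rightarrow> 'r list" where
  "fires_acc A [] xs = xs"
| "fires_acc A (i # w) xs = fires_acc A w (fire_list A i xs)"

definition fires_list :: "'r::linordered_idom list list \<Rightarrow> nat list \<Rightarrow> 'r list \<Rightarrow> 'r list" where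
  "fires_list A w xs = fires_acc A (rev w) xs"

lemma fires_list_simps:
  "fires_list A [] xs = xs"
  "fires_list A (i # w) xs = fire_list A i (fires_list A w xs)"
proof -
  have "fires_acc A (u @ [i]) xs = fire_list A i (fires_acc A u xs)" for u
    by (induction u arbitrary: xs) simp_all
  then show "fires_list A [] xs = xs" "fires_list A (i # w) xs = fire_list A i (fires_list A w xs)"
    by (simp_all add: fires_list_def)
qed

text \<open>Nodes count from 1 and list positions from 0. Off the graph all values and coefficients
  are 0, so firing leaves them 0.\<close>

definition config :: "'r::linordered_idom list \<Rightarrow> nat \<Rightarrow> 'r" where
  "config xs l = (if l \<in> {1..length xs} then xs ! (l - 1) else 0)"

lemma length_add_row [simp]:
  "length row = length xs \<Longrightarrow> length (add_row xs x row) = length xs"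
  by (simp add: add_row_def)

lemma length_fire_list [simp]:
  "table A \<Longrightarrow> length xs = length A \<Longrightarrow> i \<in> {1..length A} \<Longrightarrow> length (fire_list A i xs) = length A"
  by (auto simp: fire_list_def table_def)

lemma config_fire:
  assumes "table A" "length xs = length A" "i \<in> {1..length A}"
  shows "fire (coeff A) i (config xs) = config (fire_list A i xs)"
proof
  fix l
  have row: "length (A ! (i - 1)) = length A" "A ! (i - 1) ! (i - 1) = - 2"
    using assms unfolding table_def by auto
  show "fire (coeff A) i (config xs) l = config (fire_list A i xs) l"
  proof (cases "l \<in> {1..length A}")
    case True
    then have "fire_list A i xs ! (l - 1) = xs ! (l - 1) + xs ! (i - 1) * A ! (i - 1) ! (l - 1)"
      using row assms(2) by (auto simp: fire_list_def add_row_def)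
    then show ?thesis using True assms row
      by (simp add: fire_def config_def coeff_def mult.commute)
  next
    case False
    then show ?thesis using assms by (auto simp: fire_def config_def coeff_def)
  qed
qed

lemma config_fires:
  assumes "table A" "length xs = length A" "set w \<subseteq> {1..length A}"
  shows "fires (coeff A) w (config xs) = config (fires_list A w xs) \<and>
    length (fires_list A w xs) = length A"
  using assms(3)
proof (induction w)
  case Nil
  then show ?case using assms(2) by (simp add: fires_list_simps)
next
  case (Cons i w)
  then show ?case using config_fire[OF assms(1)] length_fire_list[OF assms(1)]
    by (simp add: fires_list_simps)
qed

definition descents :: "'r::linordered_idom list list \<Rightarrow> 'r list \<Rightarrow> 'r list list" where
  "descents A xs = map (\<lambda>(x, row). add_row xs x row) (filter (\<lambda>(x, row). 0 < x) (zip xs A))"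

lemma descents_fire:
  assumes "length xs = length A" "i \<in> {1..length A}" "0 < config xs i"
  shows "fire_list A i xs \<in> set (descents A xs)"
proof -
  have "(xs ! (i - 1), A ! (i - 1)) \<in> set (zip xs A)"
    using assms by (auto simp: in_set_zip intro!: exI[of _ "i - 1"])
  moreover have "0 < xs ! (i - 1)" using assms by (simp add: config_def)
  ultimately show ?thesis by (force simp: descents_def fire_list_def)
qed

text \<open>Only descending firings are generated; by \<open>act_invariant\<close> that covers the
  group orbit of a fundamental weight.\<close>

inductive_set orbit :: "'r::linordered_idom list list \<Rightarrow> 'r list \<Rightarrow> 'r list set"
  for A :: "'r list list" and v :: "'r list" where
  start: "v \<in> orbit A v"
| fire: "xs \<in> orbit A v \<Longrightarrow> ys \<in> set (descents A xs) \<Longrightarrow> ys \<in> orbit A v"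

text \<open>\<open>L\<close> holds one level of the descent. The base case demands that the levels
  are exhausted, so success certifies \<open>Q\<close> on the whole orbit. \<open>k\<close> must be
  at least the number of levels, which for a fundamental weight is one more than the number of
  reflections outside the parabolic.\<close>

primrec all_below ::
    "('r::linordered_idom list \<Rightarrow> bool) \<Rightarrow> 'r list list \<Rightarrow> nat \<Rightarrow> 'r list list \<Rightarrow> bool" where
  "all_below Q A 0 L \<longleftrightarrow> L = []"
| "all_below Q A (Suc k) L \<longleftrightarrow> list_all Q L \<and> all_below Q A k (remdups (concat (map (descents A) L)))"

lemma all_below_orbit:
  assumes "all_below Q A k [v]" "xs \<in> orbit A v"
  shows "Q xs"
proof -
  have *: "all_below Q A l L \<Longrightarrow> zs \<in> set L \<Longrightarrow> Q zs \<and> 0 < l \<and>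
      (\<forall>ys \<in> set (descents A zs). \<exists>L'. all_below Q A (l - 1) L' \<and> ys \<in> set L')" for l L zs
    by (cases l) (auto simp: list_all_iff intro!: exI[of _ "remdups (concat (map (descents A) L))"])
  have "\<exists>l L. all_below Q A l L \<and> xs \<in> set L"
    using assms(2)
  proof induction
    case start
    then show ?case using assms(1) by (intro exI[of _ k] exI[of _ "[v]"]) simp
  next
    case (fire zs ys)
    then show ?case using * by blast
  qed
  then show ?thesis using * by blast
qed

lemma length_orbit:
  assumes "table A" "length v = length A" "xs \<in> orbit A v"
  shows "length xs = length A"
  using assms(3)
proof induction
  case (fire xs ys)
  then obtain i where "i < length A" "ys = add_row xs (xs ! i) (A ! i)"
    by (auto simp: descents_def in_set_zip)
  then show ?case using fire assms(1) by (simp add: table_def)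
qed (use assms in simp)

lemma orbit_closed:
  assumes "table A" "length v = length A" and "z \<in> config ` orbit A v"
    and "i \<in> {1..length A}" "0 < z i"
  shows "fire (coeff A) i z \<in> config ` orbit A v"
proof -
  obtain xs where xs: "xs \<in> orbit A v" "z = config xs" using assms(3) by blast
  then have "fire_list A i xs \<in> orbit A v"
    using orbit.fire descents_fire length_orbit[OF assms(1,2)] assms(4,5) by metis
  then show ?thesis using xs config_fire[OF assms(1) _ assms(4)] length_orbit[OF assms(1,2)] by auto
qed

definition others :: "nat \<Rightarrow> 'b list \<Rightarrow> 'b list" where
  "others j xs = take (j - 1) xs @ drop j xs"

lemma set_others:
  assumes j: "j \<in> {1..length xs}"
  shows "set (others j xs) = {config xs i | i. i \<in> {1..length xs} - {j}}"
proof
  show "set (others j xs) \<subseteq> {config xs i | i. i \<in> {1..length xs} - {j}}"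
  proof
    fix x assume "x \<in> set (others j xs)"
    then consider k where "k < j - 1" "x = xs ! k" | k where "k < length xs - j" "x = xs ! (j + k)"
      using j by (auto simp: others_def in_set_conv_nth)
    then show "x \<in> {config xs i | i. i \<in> {1..length xs} - {j}}"
    proof cases
      case 1
      then show ?thesis using j by (intro CollectI exI[of _ "Suc k"]) (auto simp: config_def)
    next
      case 2
      then show ?thesis using j by (intro CollectI exI[of _ "Suc (j + k)"]) (auto simp: config_def)
    qed
  qed
  show "{config xs i | i. i \<in> {1..length xs} - {j}} \<subseteq> set (others j xs)"
  proof
    fix x assume "x \<in> {config xs i | i. i \<in> {1..length xs} - {j}}"
    then obtain i where i: "i \<in> {1..length xs} - {j}" "x = xs ! (i - 1)" by (auto simp: config_def)
    show "x \<in> set (others j xs)"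
    proof (cases "i < j")
      case True
      then have "i - 1 < length (take (j - 1) xs)" "take (j - 1) xs ! (i - 1) = x" using i j by auto
      then show ?thesis unfolding others_def by (metis UnCI nth_mem set_append)
    next
      case False
      then have "i - 1 - j < length (drop j xs)" "drop j xs ! (i - 1 - j) = x" using i j by auto
      then show ?thesis unfolding others_def by (metis UnCI nth_mem set_append)
    qed
  qed
qed

lemma list_all_others:
  assumes "length xs = r" "j \<in> {1..r}"
  shows "list_all Q (others j xs) \<longleftrightarrow> (\<forall>i\<in>{1..r} - {j}. Q (config xs i))"
proof -
  have "set (others j xs) = {config xs i | i. i \<in> {1..r} - {j}}"
    using set_others[of j xs] assms by simp
  then show ?thesis by (simp only: list_all_iff) blast
qed

text \<open>Reduces existence to evaluation. Each orbit of the parabolic has one dominant point, so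
  \<open>ps\<close> needs one pair per double coset of the parabolic.\<close>

theorem three_conjugates_by_computation:
  fixes A :: "'r::linordered_idom list list"
  assumes C: "finite_coxeter_group C n s m" and T: "has_type n m T" "type_rank T = length A"
    and A: "table A" "bonded (length A) (type_graph T) (coeff A)"
    and v: "length v = length A" "j \<in> {1..length A}" "0 < v ! (j - 1)" "list_all (\<lambda>c. c = 0) (others j v)"
    and x: "list_all (\<lambda>i. i \<in> {1..length A}) x"
    and ps: "list_all (\<lambda>(p, q). list_all (\<lambda>i. i \<in> {1..length A} \<and> i \<noteq> j) (p @ q)) ps"
    and comp: "all_below (\<lambda>xs. if list_all (\<lambda>c. 0 \<le> c) (others j xs)
        then list_ex (\<lambda>(p, q). xs = fires_list A (p @ x @ q @ rev x) v) ps else True) A k [v]"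
  shows "\<exists>P. parabolic_subgroup C n s P \<and> P \<noteq> carrier C \<and> product_of_three_conjugates C P"
proof (rule three_conjugates_criterion[OF C T(1), of "coeff A" j "config v" x "config ` orbit A v"])
  show "bonded (type_rank T) (type_graph T) (coeff A)" using A T by simp
  show "j \<in> {1..type_rank T}" using v T by simp
  show "0 < config v j" using v by (simp add: config_def)
  show "config v i = 0" if "i \<in> {1..type_rank T} - {j}" for i
    using v(4)[unfolded list_all_others[OF v(1,2)]] that unfolding T(2) by (rule bspec)
  show "set x \<subseteq> {1..type_rank T}" using x T by (auto simp: list_all_iff)
  show "config v \<in> config ` orbit A v" by (simp add: orbit.start)
  show "fire (coeff A) i z \<in> config ` orbit A v"
    if "z \<in> config ` orbit A v" "i \<in> {1..type_rank T}" "0 < z i" for z i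
    using that orbit_closed[OF A(1) v(1)] T by simp
  show "reached (coeff A) ({1..type_rank T} - {j}) (config v) x z"
    if z: "z \<in> config ` orbit A v" and dom: "\<And>i. i \<in> {1..type_rank T} - {j} \<Longrightarrow> 0 \<le> z i" for z
  proof -
    obtain xs where xs: "xs \<in> orbit A v" "z = config xs" using z by blast
    have len: "length xs = length A" using length_orbit[OF A(1) v(1) xs(1)] .
    have "list_all (\<lambda>c. 0 \<le> c) (others j xs)"
      unfolding list_all_others[OF len v(2)] by (rule ballI[OF dom[unfolded T(2) xs(2)]])
    then obtain p q where pq: "(p, q) \<in> set ps" "xs = fires_list A (p @ x @ q @ rev x) v"
      using all_below_orbit[OF comp xs(1)] by (auto simp: list_ex_iff split: if_splits)
    then have sub: "set p \<subseteq> {1..length A} - {j}" "set q \<subseteq> {1..length A} - {j}"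
      using ps by (auto simp: list_all_iff)
    then have "set (p @ x @ q @ rev x) \<subseteq> {1..length A}" using x by (auto simp: list_all_iff)
    from config_fires[OF A(1) v(1) this] have "z = fires (coeff A) (p @ x @ q @ rev x) (config v)"
      unfolding xs(2) pq(2) by (simp only:)
    then show ?thesis using sub unfolding reached_def T(2) by blast
  qed
qed

text \<open>Configurations are coordinates in the basis of fundamental weights, so \<open>B\<close>
  is to be a multiple of the Gram matrix of these weights.\<close>

definition form :: "'r::linordered_idom list list \<Rightarrow> 'r list \<Rightarrow> 'r list \<Rightarrow> 'r" where
  "form B xs ys = sum_list (map2 (\<lambda>x row. x * sum_list (map2 (*) row ys)) xs B)"

definition invariant_form :: "'r::linordered_idom list list \<Rightarrow> 'r list list \<Rightarrow> bool" where
  "invariant_form A B \<longleftrightarrow> (\<forall>xs ys. length xs = length A \<longrightarrow> length ys = length A \<longrightarrow>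
     form B xs ys = form B ys xs \<and> form B (map uminus xs) ys = - form B xs ys \<and>
     (\<forall>i\<in>{1..length A}. form B (fire_list A i xs) (fire_list A i ys) = form B xs ys))"

definition unit_list :: "nat \<Rightarrow> nat \<Rightarrow> 'r::linordered_idom list" where
  "unit_list r j = map (\<lambda>i. if i = j then 1 else 0) [1..<Suc r]"

text \<open>The second point is \<open>s_j \<omega>\<close>. It differs from \<open>\<omega>\<close>
  by a multiple of the \<open>j\<close>-th root, so the test says that no orbit point orthogonal to
  \<open>\<omega>\<close> is orthogonal to that root.\<close>

definition no_common_neighbour ::
    "'r::linordered_idom list list \<Rightarrow> 'r list list \<Rightarrow> nat \<Rightarrow> nat list \<Rightarrow> nat \<Rightarrow> 'r list \<Rightarrow> bool" where
  "no_common_neighbour A B j w0 k v \<longleftrightarrow>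
     list_all (\<lambda>i. i \<in> {1..length A}) w0 \<and> fires_list A w0 v = map uminus v \<and>
     all_below (\<lambda>xs. form B v xs = 0 \<longrightarrow> form B (fires_list A [j] v) xs \<noteq> 0) A k [v]"

theorem no_three_conjugates_by_computation:
  fixes A :: "'r::linordered_idom list list"
  assumes C: "finite_coxeter_group C n s m" and T: "has_type n m T" "type_rank T = length A"
    and A: "table A" "bonded (length A) (type_graph T) (coeff A)" "A \<noteq> []"
    and B: "invariant_form A B"
    and comp: "list_all2 (\<lambda>j (w0, k). no_common_neighbour A B j w0 k (unit_list (length A) j))
      [1..<Suc (length A)] ws"
  shows "\<not> (\<exists>P. parabolic_subgroup C n s P \<and> P \<noteq> carrier C \<and> product_of_three_conjugates C P)"
proof -
  \<comment> \<open>Configurations are functions on all naturals; the form may only read their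
    values at the nodes.\<close>
  define restrict where "restrict c = map c [1..<Suc (length A)]" for c :: "nat \<Rightarrow> 'r"
  have len: "length (restrict c) = length A" for c by (simp add: restrict_def del: upt_Suc)
  have restrict_config: "restrict (config xs) = xs" if "length xs = length A" for xs
    using that by (intro nth_equalityI) (auto simp: restrict_def config_def simp del: upt_Suc)
  have config_restrict: "config (restrict c) l = c l" if "l \<in> {1..length A}" for c l
    using that by (auto simp: restrict_def config_def simp del: upt_Suc)
  have restrict_fire: "restrict (fire (coeff A) i c) = fire_list A i (restrict c)"
    if i: "i \<in> {1..length A}" for i c
  proof -
    have "restrict (fire (coeff A) i c) = restrict (fire (coeff A) i (config (restrict c)))"
    proof -
      have "fire (coeff A) i c l = fire (coeff A) i (config (restrict c)) l"
        if "l \<in> set [1..<Suc (length A)]" for l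
      proof -
        have "l \<in> {1..length A}" using that by auto
        then show ?thesis using config_restrict[of l c] config_restrict[OF i, of c]
          by (simp only: fire_def)
      qed
      then show ?thesis by (simp only: restrict_def[of "fire _ _ _"] cong: map_cong)
    qed
    also have "\<dots> = fire_list A i (restrict c)"
      using config_fire[OF A(1) len i] restrict_config length_fire_list[OF A(1) len i] by simp
    finally show ?thesis .
  qed
  show ?thesis
  proof (rule no_three_conjugates_criterion[OF C T(1),
        of "coeff A" "\<lambda>c d. form B (restrict c) (restrict d)"])
    show "bonded (type_rank T) (type_graph T) (coeff A)" using A T by simp
    show "0 < type_rank T" using A T by simp
    show "form B (restrict (fire (coeff A) i c)) (restrict (fire (coeff A) i d)) =
        form B (restrict c) (restrict d)" if "i \<in> {1..type_rank T}" for i c d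
      using B that T restrict_fire len unfolding invariant_form_def by simp
    show "form B (restrict c) (restrict d) = form B (restrict d) (restrict c)" for c d
      using B len unfolding invariant_form_def by blast
    show "form B (restrict (\<lambda>l. - c l)) (restrict d) = - form B (restrict c) (restrict d)" for c d
    proof -
      have "restrict (\<lambda>l. - c l) = map uminus (restrict c)" by (simp add: restrict_def)
      then show ?thesis using B len unfolding invariant_form_def by metis
    qed
    fix j assume "j \<in> {1..type_rank T}"
    then have j: "j \<in> {1..length A}" using T by simp
    define v where "v = (unit_list (length A) j :: 'r list)"
    define w where "w = [j]"
    have "j - 1 < length [1..<Suc (length A)]" "[1..<Suc (length A)] ! (j - 1) = j"
      using j by (auto simp del: upt_Suc)
    then obtain w0 k where "no_common_neighbour A B j w0 k v"
      using list_all2_nthD[OF comp, of "j - 1"] unfolding v_def by (auto simp del: upt_Suc)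
    then have nb: "set w0 \<subseteq> {1..length A}" "fires_list A w0 v = map uminus v"
        "all_below (\<lambda>xs. form B v xs = 0 \<longrightarrow> form B (fires_list A w v) xs \<noteq> 0) A k [v]"
      by (auto simp: no_common_neighbour_def list_all_iff w_def)
    have v: "length v = length A" by (simp add: v_def unit_list_def del: upt_Suc)
    have config_v: "config v i = (if i = j then 1 else 0)" if "i \<in> {1..length A}" for i
      using that v by (auto simp: config_def v_def unit_list_def simp del: upt_Suc)
    have w: "set w0 \<subseteq> {1..length A}" "set w \<subseteq> {1..length A}" using nb(1) j by (auto simp: w_def)
    show "\<exists>\<omega> S w0 w. 0 < \<omega> j \<and> (\<forall>i\<in>{1..type_rank T} - {j}. \<omega> i = 0) \<and> \<omega> \<in> S \<and>
      (\<forall>z\<in>S. \<forall>i\<in>{1..type_rank T}. 0 < z i \<longrightarrow> fire (coeff A) i z \<in> S) \<and>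
      set w0 \<subseteq> {1..type_rank T} \<and> fires (coeff A) w0 \<omega> = (\<lambda>l. - \<omega> l) \<and> set w \<subseteq> {1..type_rank T} \<and>
      (\<forall>z\<in>S. form B (restrict \<omega>) (restrict z) = 0 \<longrightarrow>
        form B (restrict (fires (coeff A) w \<omega>)) (restrict z) \<noteq> 0)"
    proof (rule exI[of _ "config v"], rule exI[of _ "config ` orbit A v"], rule exI[of _ w0],
        rule exI[of _ w], intro conjI ballI impI)
      show "0 < config v j" using config_v[OF j] by simp
      show "config v i = 0" if "i \<in> {1..type_rank T} - {j}" for i
        using that config_v[of i] T(2) by auto
      show "config v \<in> config ` orbit A v" by (simp add: orbit.start)
      show "fire (coeff A) i z \<in> config ` orbit A v"
        if "z \<in> config ` orbit A v" "i \<in> {1..type_rank T}" "0 < z i" for z i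
        using that orbit_closed[OF A(1) v] T by simp
      show "set w0 \<subseteq> {1..type_rank T}" "set w \<subseteq> {1..type_rank T}" using w T by simp_all
      show "fires (coeff A) w0 (config v) = (\<lambda>l. - config v l)"
        using config_fires[OF A(1) v w(1)] nb(2) v by (auto simp: config_def fun_eq_iff)
      fix z assume z: "z \<in> config ` orbit A v" "form B (restrict (config v)) (restrict z) = 0"
      then obtain xs where xs: "xs \<in> orbit A v" "z = config xs" by blast
      then have r: "restrict z = xs" using restrict_config length_orbit[OF A(1) v] by simp
      have "restrict (fires (coeff A) w (config v)) = fires_list A w v"
        using config_fires[OF A(1) v w(2)] restrict_config by simp
      then show "form B (restrict (fires (coeff A) w (config v))) (restrict z) \<noteq> 0"
        using all_below_orbit[OF nb(3) xs(1)] z(2) unfolding r restrict_config[OF v] by simp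
    qed
  qed
qed

section \<open>Graphs given by lists of edges\<close>

definition edges :: "(nat \<times> nat \<times> nat) list \<Rightarrow> (nat set \<times> nat) set" where
  "edges es = (\<lambda>(i, j, k). ({i, j}, k)) ` set es"

text \<open>Requiring \<open>i < j\<close> in each triple makes the unordered edge determine the
  triple, so edges can be compared as lists of numbers.\<close>

definition bonded_list ::
    "nat \<Rightarrow> (nat \<times> nat \<times> nat) list \<Rightarrow> (nat \<Rightarrow> nat \<Rightarrow> 'r::linordered_idom) \<Rightarrow> bool" where
  "bonded_list r es a \<longleftrightarrow> list_all (\<lambda>(i, j, k). i < j) es \<and>
     list_all (\<lambda>i. list_all (\<lambda>j. i < j \<longrightarrow>
       list_ex (\<lambda>(u, v, k). u = i \<and> v = j \<and> k \<in> {3, 4, 5} \<and> bond a k i j) es \<or>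
       a i j = 0 \<and> a j i = 0 \<and> list_all (\<lambda>(u, v, k). u \<noteq> i \<or> v \<noteq> j) es) [1..<Suc r]) [1..<Suc r]"

lemma bonded_edges:
  assumes "bonded_list r es a"
  shows "bonded r (edges es) a"
  unfolding bonded_def
proof (intro ballI impI)
  fix i j assume ij: "i \<in> {1..r}" "j \<in> {1..r}" "i < j"
  have iff: "({i, j}, k) \<in> edges es \<longleftrightarrow> (i, j, k) \<in> set es" for k
  proof
    assume "({i, j}, k) \<in> edges es"
    then obtain u v where uv: "(u, v, k) \<in> set es" "{i, j} = {u, v}" by (auto simp: edges_def)
    then have "u < v" using assms by (auto simp: bonded_list_def list_all_iff)
    then show "(i, j, k) \<in> set es" using uv ij(3) by (auto simp: doubleton_eq_iff)
  qed (force simp: edges_def)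
  have "i \<in> set [1..<Suc r]" "j \<in> set [1..<Suc r]" using ij by auto
  then have "list_ex (\<lambda>(u, v, k). u = i \<and> v = j \<and> k \<in> {3, 4, 5} \<and> bond a k i j) es \<or>
      a i j = 0 \<and> a j i = 0 \<and> list_all (\<lambda>(u, v, k). u \<noteq> i \<or> v \<noteq> j) es"
    using assms ij(3) unfolding bonded_list_def list_all_iff[of _ "[1..<Suc r]"] by blast
  then consider
      "list_ex (\<lambda>(u, v, k). u = i \<and> v = j \<and> k \<in> {3, 4, 5} \<and> bond a k i j) es"
    | "a i j = 0" "a j i = 0" "list_all (\<lambda>(u, v, k). u \<noteq> i \<or> v \<noteq> j) es"
    by blast
  then show "(\<exists>k\<in>{3, 4, 5}. ({i, j}, k) \<in> edges es \<and> bond a k i j) \<or>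
      (\<forall>k. ({i, j}, k) \<notin> edges es) \<and> a i j = 0 \<and> a j i = 0"
  proof cases
    case 1
    then obtain k where "(i, j, k) \<in> set es" "k \<in> {3, 4, 5}" "bond a k i j"
      unfolding list_ex_iff by blast
    then show ?thesis unfolding iff by blast
  next
    case 2
    then show ?thesis unfolding iff list_all_iff by blast
  qed
qed

lemma path_graph_edges: "path_graph n = edges (map (\<lambda>i. (i, i + 1, 3)) [1..<n])"
  by (auto simp: path_graph_def edges_def image_image)

lemma edges_append [simp]: "edges (xs @ ys) = edges xs \<union> edges ys"
  by (simp add: edges_def image_Un)

lemma edges_single [simp]: "edges [(i, j, k)] = {({i, j}, k)}"
  by (simp add: edges_def)

lemma table_code [code]:
  "table A \<longleftrightarrow> list_all (\<lambda>i. length (A ! i) = length A \<and> A ! i ! i = - 2) [0..<length A]"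
  by (auto simp: table_def list_all_iff)

section \<open>Types \<open>E_6\<close>, \<open>E_7\<close>, \<open>E_8\<close> by
  computation\<close>

definition table_E6 :: "int list list" where
  "table_E6 = [[- 2, 1, 0, 0, 0, 0], [1, - 2, 1, 0, 0, 0], [0, 1, - 2, 1, 0, 1],
     [0, 0, 1, - 2, 1, 0], [0, 0, 0, 1, - 2, 0], [0, 0, 1, 0, 0, - 2]]"

definition table_E7 :: "int list list" where
  "table_E7 = [[- 2, 1, 0, 0, 0, 0, 0], [1, - 2, 1, 0, 0, 0, 0], [0, 1, - 2, 1, 0, 0, 1],
     [0, 0, 1, - 2, 1, 0, 0], [0, 0, 0, 1, - 2, 1, 0], [0, 0, 0, 0, 1, - 2, 0], [0, 0, 1, 0, 0, 0, - 2]]"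

definition table_E8 :: "int list list" where
  "table_E8 = [[- 2, 1, 0, 0, 0, 0, 0, 0], [1, - 2, 1, 0, 0, 0, 0, 0], [0, 1, - 2, 1, 0, 0, 0, 1],
     [0, 0, 1, - 2, 1, 0, 0, 0], [0, 0, 0, 1, - 2, 1, 0, 0], [0, 0, 0, 0, 1, - 2, 1, 0],
     [0, 0, 0, 0, 0, 1, - 2, 0], [0, 0, 1, 0, 0, 0, 0, - 2]]"

text \<open>The words \<open>p\<close>, \<open>q\<close> and \<open>x\<close> below were found by a computer search.\<close>

lemma three_conjugates_E6:
  assumes "finite_coxeter_group C n s m" "has_type n m (Type_E 6)"
  shows "\<exists>P. parabolic_subgroup C n s P \<and> P \<noteq> carrier C \<and> product_of_three_conjugates C P"
\<comment> \<open>The parabolic has type \<open>D_5\<close> and orbits of 1, 16 and 10 points, one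
  pair each; 36 - 20 reflections lie outside it, whence 17 levels.\<close>
proof (rule three_conjugates_by_computation[where A = table_E6 and j = 1 and v = "[1, 0, 0, 0, 0, 0]"
      and x = "[1]" and k = 17
      and ps = "[([], []), ([2], [2]), ([], [2, 3, 6, 4, 3, 2])]", OF assms])
  let ?es = "map (\<lambda>i. (i, i + 1, 3)) [1..<5] @ [(3, 6, 3)]"
  have "type_graph (Type_E 6) = edges ?es" by (simp add: path_graph_edges)
  moreover have "bonded_list (length table_E6) ?es (coeff table_E6)" by code_simp
  ultimately show "bonded (length table_E6) (type_graph (Type_E 6)) (coeff table_E6)"
    by (simp only: bonded_edges)
qed code_simp+

text \<open>\<open>v\<close> is the highest root and the parabolic has type \<open>D_6\<close>. The
  five pairs correspond to the five possible pairings of a root with \<open>v\<close>;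
  \<open>x\<close> sends \<open>v\<close> to the highest root of \<open>D_6\<close>, which is
  orthogonal to it.\<close>

lemma three_conjugates_E7:
  assumes "finite_coxeter_group C n s m" "has_type n m (Type_E 7)"
  shows "\<exists>P. parabolic_subgroup C n s P \<and> P \<noteq> carrier C \<and> product_of_three_conjugates C P"
proof (rule three_conjugates_by_computation[where A = table_E7 and j = 1 and v = "[1, 0, 0, 0, 0, 0, 0]"
      and x = "[1, 2, 3, 7, 4, 3, 2, 1]" and k = 34
      and ps = "[([], []), ([2, 3, 4, 5], [5]), ([5, 4, 6, 5], [5, 6, 4, 5]),
        ([2, 3, 4, 5], [5, 4, 3, 7, 6, 2, 3, 4, 5]),
        ([], [5, 6, 4, 5, 3, 4, 2, 3, 7, 3, 4, 5, 6, 2, 3, 4, 5])]", OF assms])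
  let ?es = "map (\<lambda>i. (i, i + 1, 3)) [1..<6] @ [(3, 7, 3)]"
  have "type_graph (Type_E 7) = edges ?es" by (simp add: path_graph_edges)
  moreover have "bonded_list (length table_E7) ?es (coeff table_E7)" by code_simp
  ultimately show "bonded (length table_E7) (type_graph (Type_E 7)) (coeff table_E7)"
    by (simp only: bonded_edges)
qed code_simp+

text \<open>As for \<open>E_7\<close>, now with a parabolic of type \<open>E_7\<close>, whose
  highest root is the image of \<open>v\<close> under \<open>x\<close>.\<close>

lemma three_conjugates_E8:
  assumes "finite_coxeter_group C n s m" "has_type n m (Type_E 8)"
  shows "\<exists>P. parabolic_subgroup C n s P \<and> P \<noteq> carrier C \<and> product_of_three_conjugates C P"
proof (rule three_conjugates_by_computation[where A = table_E8 and j = 7 and v = "[0, 0, 0, 0, 0, 0, 1, 0]"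
      and x = "[7, 6, 5, 4, 3, 8, 2, 3, 4, 5, 6, 7]" and k = 58
      and ps = "[([], []), ([6, 5, 4, 3, 2, 1], [1]),
        ([1, 2, 3, 4, 8, 3, 2, 1], [1, 2, 3, 8, 4, 3, 2, 1]),
        ([6, 5, 4, 3, 2, 1], [1, 2, 3, 8, 4, 5, 3, 4, 2, 3, 8, 6, 5, 4, 3, 2, 1]),
        ([], [1, 2, 3, 8, 4, 5, 6, 3, 4, 5, 2, 3, 4, 1, 2, 3, 8, 3, 4, 5, 2, 3, 4, 1, 2, 3, 8, 6, 5, 4, 3, 2, 1])]",
       OF assms])
  let ?es = "map (\<lambda>i. (i, i + 1, 3)) [1..<7] @ [(3, 8, 3)]"
  have "type_graph (Type_E 8) = edges ?es" by (simp add: path_graph_edges)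
  moreover have "bonded_list (length table_E8) ?es (coeff table_E8)" by code_simp
  ultimately show "bonded (length table_E8) (type_graph (Type_E 8)) (coeff table_E8)"
    by (simp only: bonded_edges)
qed code_simp+

section \<open>The ring of golden integers\<close>

text \<open>\<open>Golden a b\<close> stands for \<open>a + b \<phi>\<close>, where \<open>\<phi>\<^sup>2 = \<phi> + 1\<close>.\<close>

datatype golden = Golden (rational_part: int) (golden_part: int)

definition golden_ratio :: real where
  "golden_ratio = (1 + sqrt 5) / 2"

lemma golden_ratio: "golden_ratio * golden_ratio = golden_ratio + 1" "1 < golden_ratio"
proof -
  show "golden_ratio * golden_ratio = golden_ratio + 1"
    by (simp add: golden_ratio_def field_simps)
  have "1 < sqrt 5" by simp
  then show "1 < golden_ratio" by (simp add: golden_ratio_def)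
qed

lemma golden_ratio_mult: "golden_ratio * (golden_ratio * x) = golden_ratio * x + x"
  by (simp add: mult.assoc[symmetric] golden_ratio distrib_right)

definition real_of_golden :: "golden \<Rightarrow> real" where
  "real_of_golden x = of_int (rational_part x) + of_int (golden_part x) * golden_ratio"

text \<open>Infinite descent by halving: \<open>a * a + a * b - b * b\<close> is odd unless both
  numbers are even.\<close>

lemma golden_norm_eq_0: "a * a + a * b = b * b \<Longrightarrow> a = 0 \<and> b = 0" for a b :: int
proof (induction "nat (\<bar>a\<bar> + \<bar>b\<bar>)" arbitrary: a b rule: less_induct)
  case less
  have "even a \<and> even b"
  proof (rule ccontr)
    assume "\<not> ?thesis"
    then have "odd (a * a + a * b - b * b)" by auto
    then show False using less.prems by simp
  qed
  then obtain c d where cd: "a = 2 * c" "b = 2 * d" by (auto elim!: evenE)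
  then have "c * c + c * d = d * d" using less.prems by simp
  show ?case
  proof (rule ccontr)
    assume "\<not> ?thesis"
    then have "0 < \<bar>c\<bar> + \<bar>d\<bar>" using cd by auto
    then have "nat (\<bar>c\<bar> + \<bar>d\<bar>) < nat (\<bar>a\<bar> + \<bar>b\<bar>)" using cd by (simp add: abs_mult)
    from less.hyps[OF this \<open>c * c + c * d = d * d\<close>] show False using \<open>0 < \<bar>c\<bar> + \<bar>d\<bar>\<close> by simp
  qed
qed

text \<open>\<open>1 - golden_ratio\<close> is the conjugate of the golden ratio; the product is the
  norm.\<close>

lemma real_of_golden_mult_conjugate:
  "(of_int a + of_int b * golden_ratio) * (of_int a + of_int b * (1 - golden_ratio)) =
   of_int (a * a + a * b - b * b)"
  by (simp add: algebra_simps golden_ratio golden_ratio_mult)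

lemma inj_real_of_golden: "real_of_golden x = real_of_golden y \<Longrightarrow> x = y"
proof -
  assume eq: "real_of_golden x = real_of_golden y"
  define a b where "a = rational_part x - rational_part y" and "b = golden_part x - golden_part y"
  have "of_int a + of_int b * golden_ratio = 0"
    using eq by (simp add: real_of_golden_def a_def b_def algebra_simps)
  then have "real_of_int (a * a + a * b - b * b) = 0"
    using real_of_golden_mult_conjugate[of a b] by simp
  then have "a * a + a * b = b * b" by linarith
  from golden_norm_eq_0[OF this] show "x = y" by (simp add: a_def b_def golden.expand)
qed

text \<open>A sign test in integer arithmetic, so that evaluation never meets a real number. If
  \<open>a\<close> and \<open>b\<close> have opposite signs, the conjugate has the sign of
  \<open>a\<close>, and the sign of the norm decides.\<close>

fun golden_pos :: "int \<Rightarrow> int \<Rightarrow> bool" where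
  "golden_pos a b \<longleftrightarrow>
     (if 0 \<le> b then 0 < a \<or> 0 < b \<and> (0 \<le> a \<or> a * a + a * b < b * b) else 0 < a \<and> b * b < a * a + a * b)"

lemma golden_pos: "golden_pos a b \<longleftrightarrow> 0 < of_int a + of_int b * golden_ratio"
proof -
  define f g where "f = golden_ratio" and "g = 1 - golden_ratio"
  have fg: "0 < f" "g < 0" using golden_ratio(2) by (simp_all add: f_def g_def)
  define N where "N = a * a + a * b - b * b"
  have conj: "real_of_int N = (of_int a + of_int b * f) * (of_int a + of_int b * g)"
    unfolding f_def g_def N_def by (rule real_of_golden_mult_conjugate[symmetric])
  consider "0 \<le> a" "0 \<le> b" | "a < 0" "0 < b" | "0 < a" "b < 0" | "a \<le> 0" "b \<le> 0" by linarith
  then have "golden_pos a b \<longleftrightarrow> 0 < of_int a + of_int b * f"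
  proof cases
    case 1
    then have "0 \<le> of_int b * f" "0 < b \<Longrightarrow> 0 < of_int b * f" using fg by simp_all
    then show ?thesis using 1 by (cases "b = 0") (auto simp: add_nonneg_pos)
  next
    case 2
    then have "of_int b * g < 0" using fg by (simp add: mult_pos_neg)
    then have "of_int a + of_int b * g < 0" using 2 by linarith
    then have "real_of_int N < 0 \<longleftrightarrow> 0 < of_int a + of_int b * f"
      unfolding conj by (simp add: mult_less_0_iff)
    then show ?thesis using 2 unfolding of_int_less_0_iff by (auto simp: N_def)
  next
    case 3
    then have "0 < of_int b * g" using fg by (simp add: mult_neg_neg)
    then have "0 < of_int a + of_int b * g" using 3 by linarith
    then have "0 < real_of_int N \<longleftrightarrow> 0 < of_int a + of_int b * f"
      unfolding conj by (simp add: zero_less_mult_iff)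
    then show ?thesis using 3 unfolding of_int_0_less_iff by (auto simp: N_def)
  next
    case 4
    then have "of_int b * f \<le> 0" using fg by (simp add: mult_nonpos_nonneg)
    then show ?thesis using 4 by auto
  qed
  then show ?thesis by (simp add: f_def)
qed

instantiation golden :: linordered_idom
begin

definition "0 = Golden 0 0"
definition "1 = Golden 1 0"
definition "x + y = Golden (rational_part x + rational_part y) (golden_part x + golden_part y)"
definition "x - y = Golden (rational_part x - rational_part y) (golden_part x - golden_part y)"
definition "- x = Golden (- rational_part x) (- golden_part x)"
definition "x * y = Golden (rational_part x * rational_part y + golden_part x * golden_part y)
  (rational_part x * golden_part y + golden_part x * rational_part y + golden_part x * golden_part y)"
definition "x < y \<longleftrightarrow>
  golden_pos (rational_part y - rational_part x) (golden_part y - golden_part x)"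
definition "x \<le> y \<longleftrightarrow> x < y \<or> x = (y :: golden)"
definition "\<bar>x\<bar> = (if x < 0 then - x else x :: golden)"
definition "sgn x = (if x = 0 then 0 else if 0 < x then 1 else - 1 :: golden)"

lemma real_of_golden_simps:
  "real_of_golden 0 = 0" "real_of_golden 1 = 1"
  "real_of_golden (x + y) = real_of_golden x + real_of_golden y"
  "real_of_golden (x - y) = real_of_golden x - real_of_golden y"
  "real_of_golden (- x) = - real_of_golden x"
  by (simp_all add: real_of_golden_def zero_golden_def one_golden_def plus_golden_def
      minus_golden_def uminus_golden_def algebra_simps)

lemma real_of_golden_mult: "real_of_golden (x * y) = real_of_golden x * real_of_golden y"
  by (simp add: real_of_golden_def times_golden_def algebra_simps golden_ratio golden_ratio_mult)

lemma golden_less_iff: "x < y \<longleftrightarrow> real_of_golden x < real_of_golden y"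
  by (simp add: less_golden_def golden_pos real_of_golden_def algebra_simps del: golden_pos.simps)

lemma golden_le_iff: "x \<le> y \<longleftrightarrow> real_of_golden x \<le> real_of_golden y"
  using inj_real_of_golden[of x y]
  by (auto simp: less_eq_golden_def golden_less_iff order_le_less[of "real_of_golden x"])

lemma golden_eq_iff: "x = y \<longleftrightarrow> real_of_golden x = real_of_golden y"
  using inj_real_of_golden by blast

instance
proof
  fix x y z :: golden
  \<comment> \<open>The axioms are pulled back from the reals along the injective, order-reflecting
    ring homomorphism \<open>real_of_golden\<close>.\<close>
  note simps = golden_eq_iff golden_le_iff golden_less_iff real_of_golden_simps real_of_golden_mult
  show "x * y * z = x * (y * z)" "x * y = y * x" "1 * x = x" "x + y + z = x + (y + z)"
    "x + y = y + x" "0 + x = x" "- x + x = 0" "x - y = x + - y" "(x + y) * z = x * z + y * z"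
    "x + y - x = y" "x - y - z = x - (y + z)" "0 * x = 0" "x * 0 = 0" "(0 :: golden) \<noteq> 1"
    by (simp_all add: simps algebra_simps)
  show "x < y \<longleftrightarrow> x \<le> y \<and> \<not> y \<le> x" "x \<le> x" "x \<le> y \<Longrightarrow> y \<le> z \<Longrightarrow> x \<le> z"
    "x \<le> y \<Longrightarrow> y \<le> x \<Longrightarrow> x = y" "x \<le> y \<or> y \<le> x" "x \<le> y \<Longrightarrow> z + x \<le> z + y"
    by (auto simp: simps)
  show "x < y \<Longrightarrow> 0 < z \<Longrightarrow> z * x < z * y" by (simp add: simps)
  show "\<bar>x\<bar> = (if x < 0 then - x else x)" by (simp add: abs_golden_def)
  show "sgn x = (if x = 0 then 0 else if 0 < x then 1 else - 1)" by (simp add: sgn_golden_def)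
qed

end

section \<open>The remaining types settled by computation\<close>

definition table_H3 :: "golden list list" where
  "table_H3 = [[Golden (- 2) 0, Golden 0 1, 0], [Golden 0 1, Golden (- 2) 0, 1], [0, 1, Golden (- 2) 0]]"

definition table_H4 :: "golden list list" where
  "table_H4 = [[Golden (- 2) 0, Golden 0 1, 0, 0], [Golden 0 1, Golden (- 2) 0, 1, 0],
     [0, 1, Golden (- 2) 0, 1], [0, 0, 1, Golden (- 2) 0]]"

text \<open>The orbit is that of the 120 roots up to scaling, split by the parabolic of type
  \<open>H_3\<close> into nine orbits; \<open>x\<close> sends \<open>v\<close> to an orthogonal
  point. The 46 levels come from the 60 - 15 reflections outside the parabolic.\<close>

lemma three_conjugates_H4:
  assumes "finite_coxeter_group C n s m" "has_type n m Type_H4"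
  shows "\<exists>P. parabolic_subgroup C n s P \<and> P \<noteq> carrier C \<and> product_of_three_conjugates C P"
proof (rule three_conjugates_by_computation[where A = table_H4 and j = 4 and v = "[0, 0, 0, 1]"
      and x = "[4, 3, 2, 1, 2, 3, 4, 1, 2, 3, 1, 2, 1, 2, 3, 4]" and k = 46
      and ps = "[([], []), ([3, 2, 1, 2], [2]), ([1, 2, 1, 3, 2], [2, 1, 2]),
        ([3, 2, 1, 2], [2, 3, 1, 2]), ([2, 1, 3, 2, 1, 2], [2, 3, 1, 2, 1, 2]),
        ([3, 2, 1, 2], [2, 1, 2, 3, 2, 1, 2]), ([1, 2, 1, 3, 2], [2, 1, 2, 3, 1, 2, 1, 2]),
        ([3, 2, 1, 2], [2, 3, 1, 2, 1, 2, 3, 2, 1, 2]),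
        ([], [2, 1, 2, 3, 1, 2, 1, 2, 3, 1, 2, 1, 2])]", OF assms])
  let ?es = "[(1, 2, 5), (2, 3, 3), (3, 4, 3)]"
  have "type_graph Type_H4 = edges ?es" by (simp add: edges_def)
  moreover have "bonded_list (length table_H4) ?es (coeff table_H4)" by code_simp
  ultimately show "bonded (length table_H4) (type_graph Type_H4) (coeff table_H4)"
    by (simp only: bonded_edges)
qed code_simp+

lemma invariant_form_if:
  assumes "\<And>xs ys. length xs = length A \<Longrightarrow> length ys = length A \<Longrightarrow>
     form B xs ys = form B ys xs \<and> form B (map uminus xs) ys = - form B xs ys \<and>
     list_all (\<lambda>i. form B (fire_list A i xs) (fire_list A i ys) = form B xs ys) [1..<Suc (length A)]"
  shows "invariant_form A B"
proof -
  have "set [1..<Suc (length A)] = {1..length A}" by auto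
  then show ?thesis
    using assms unfolding invariant_form_def list_all_iff by (simp only:) blast
qed

text \<open>The adjugate of the Cartan matrix, which clears the denominators of its inverse.\<close>

definition form_H3 :: "golden list list" where
  "form_H3 = [[Golden 3 0, Golden 0 2, Golden 0 1], [Golden 0 2, Golden 4 0, Golden 2 0],
     [Golden 0 1, Golden 2 0, Golden 3 (- 1)]]"

lemma invariant_form_H3: "invariant_form table_H3 form_H3"
proof (rule invariant_form_if)
  fix xs ys :: "golden list"
  assume "length xs = length table_H3" "length ys = length table_H3"
  then obtain x1 x2 x3 x4 x5 x6 y1 y2 y3 y4 y5 y6 where
    "xs = [Golden x1 x2, Golden x3 x4, Golden x5 x6]" "ys = [Golden y1 y2, Golden y3 y4, Golden y5 y6]"
    by (simp add: table_H3_def length_Suc_conv) (metis golden.exhaust)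
  then show "form form_H3 xs ys = form form_H3 ys xs \<and>
     form form_H3 (map uminus xs) ys = - form form_H3 xs ys \<and>
     list_all (\<lambda>i. form form_H3 (fire_list table_H3 i xs) (fire_list table_H3 i ys) = form form_H3 xs ys)
       [1..<Suc (length table_H3)]"
    by (simp add: form_def form_H3_def table_H3_def fire_list_def add_row_def upt_rec
        plus_golden_def times_golden_def uminus_golden_def zero_golden_def one_golden_def algebra_simps)
qed

lemma no_three_conjugates_H3:
  assumes "finite_coxeter_group C n s m" "has_type n m Type_H3"
  shows "\<not> (\<exists>P. parabolic_subgroup C n s P \<and> P \<noteq> carrier C \<and> product_of_three_conjugates C P)"
\<comment> \<open>Each word of \<open>ws\<close> descends from a fundamental weight to its negative,
  the lowest point of the orbit, so its length is one less than the number of levels beside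
  it.\<close>
proof (rule no_three_conjugates_by_computation[where A = table_H3 and B = form_H3
      and ws = "[([1, 2, 3, 1, 2, 1, 2, 3, 2, 1, 2, 1], 13), ([2, 1, 2, 3, 1, 2, 1, 2, 3, 1, 2, 1, 2], 14),
        ([3, 2, 1, 2, 3, 1, 2, 1, 2, 3], 11)]", OF assms _ _ _ _ invariant_form_H3])
  let ?es = "[(1, 2, 5), (2, 3, 3)]"
  have "type_graph Type_H3 = edges ?es" by (simp add: edges_def)
  moreover have "bonded_list (length table_H3) ?es (coeff table_H3)" by code_simp
  ultimately show "bonded (length table_H3) (type_graph Type_H3) (coeff table_H3)"
    by (simp only: bonded_edges)
qed code_simp+

definition table_F4 :: "int list list" where
  "table_F4 = [[- 2, 1, 0, 0], [1, - 2, 1, 0], [0, 2, - 2, 1], [0, 0, 1, - 2]]"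

text \<open>The Gram matrix of the fundamental weights when the short roots, at nodes 1 and 2, have
  squared length 2.\<close>

definition form_F4 :: "int list list" where
  "form_F4 = [[2, 3, 4, 2], [3, 6, 8, 4], [4, 8, 12, 6], [2, 4, 6, 4]]"

lemma invariant_form_F4: "invariant_form table_F4 form_F4"
proof (rule invariant_form_if)
  fix xs ys :: "int list"
  assume "length xs = length table_F4" "length ys = length table_F4"
  then obtain x1 x2 x3 x4 y1 y2 y3 y4 where "xs = [x1, x2, x3, x4]" "ys = [y1, y2, y3, y4]"
    by (auto simp: table_F4_def length_Suc_conv)
  then show "form form_F4 xs ys = form form_F4 ys xs \<and>
     form form_F4 (map uminus xs) ys = - form form_F4 xs ys \<and>
     list_all (\<lambda>i. form form_F4 (fire_list table_F4 i xs) (fire_list table_F4 i ys) = form form_F4 xs ys)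
       [1..<Suc (length table_F4)]"
    by (simp add: form_def form_F4_def table_F4_def fire_list_def add_row_def upt_rec algebra_simps)
qed

lemma no_three_conjugates_F4:
  assumes "finite_coxeter_group C n s m" "has_type n m Type_F4"
  shows "\<not> (\<exists>P. parabolic_subgroup C n s P \<and> P \<noteq> carrier C \<and> product_of_three_conjugates C P)"
proof (rule no_three_conjugates_by_computation[where A = table_F4 and B = form_F4
      and ws = "[([1, 2, 3, 4, 2, 3, 1, 2, 3, 4, 1, 2, 3, 2, 1], 16),
        ([2, 3, 1, 2, 3, 4, 3, 2, 3, 1, 2, 3, 4, 2, 3, 1, 2, 3, 1, 2], 21),
        ([3, 2, 3, 1, 2, 3, 4, 3, 2, 3, 1, 2, 3, 4, 3, 2, 3, 1, 2, 3], 21),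
        ([4, 3, 2, 3, 1, 2, 3, 4, 3, 2, 3, 1, 2, 3, 4], 16)]", OF assms _ _ _ _ invariant_form_F4])
  let ?es = "[(1, 2, 3), (2, 3, 4), (3, 4, 3)]"
  have "type_graph Type_F4 = edges ?es" by (simp add: edges_def)
  moreover have "bonded_list (length table_F4) ?es (coeff table_F4)" by code_simp
  ultimately show "bonded (length table_F4) (type_graph Type_F4) (coeff table_F4)"
    by (simp only: bonded_edges)
qed code_simp+

lemma no_three_conjugates_B2:
  assumes "finite_coxeter_group C n s m" "has_type n m (Type_B 2)"
  shows "\<not> (\<exists>P. parabolic_subgroup C n s P \<and> P \<noteq> carrier C \<and> product_of_three_conjugates C P)"
proof -
  define A B :: "int list list" where "A = [[- 2, 2], [1, - 2]]" and "B = [[2, 1], [1, 1]]"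
  have inv: "invariant_form A B"
  proof (rule invariant_form_if)
    fix xs ys :: "int list"
    assume "length xs = length A" "length ys = length A"
    then obtain x1 x2 y1 y2 where "xs = [x1, x2]" "ys = [y1, y2]"
      by (auto simp: A_def length_Suc_conv)
    then show "form B xs ys = form B ys xs \<and> form B (map uminus xs) ys = - form B xs ys \<and>
       list_all (\<lambda>i. form B (fire_list A i xs) (fire_list A i ys) = form B xs ys) [1..<Suc (length A)]"
      by (simp add: form_def A_def B_def fire_list_def add_row_def upt_rec algebra_simps)
  qed
  have "type_graph (Type_B 2) = edges [(1, 2, 4)]" by (auto simp: edges_def path_graph_def)
  moreover have "bonded_list (length A) [(1, 2, 4)] (coeff A)" unfolding A_def by code_simp
  ultimately have bonded: "bonded (length A) (type_graph (Type_B 2)) (coeff A)"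
    by (simp only: bonded_edges)
  show ?thesis
  proof (rule no_three_conjugates_by_computation[OF assms _ _ bonded _ inv,
        of "[([1, 2, 1], 4), ([2, 1, 2], 4)]"])
  qed (unfold A_def B_def, code_simp+)
qed

lemma no_three_conjugates_A1:
  assumes "finite_coxeter_group C n s m" "has_type n m (Type_A 1)"
  shows "\<not> (\<exists>P. parabolic_subgroup C n s P \<and> P \<noteq> carrier C \<and> product_of_three_conjugates C P)"
proof -
  define A B :: "int list list" where "A = [[- 2]]" and "B = [[1]]"
  have inv: "invariant_form A B"
  proof (rule invariant_form_if)
    fix xs ys :: "int list"
    assume "length xs = length A" "length ys = length A"
    then obtain x y where "xs = [x]" "ys = [y]" by (auto simp: A_def length_Suc_conv)
    then show "form B xs ys = form B ys xs \<and> form B (map uminus xs) ys = - form B xs ys \<and>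
       list_all (\<lambda>i. form B (fire_list A i xs) (fire_list A i ys) = form B xs ys) [1..<Suc (length A)]"
      by (simp add: form_def A_def B_def fire_list_def add_row_def upt_rec algebra_simps)
  qed
  have bonded: "bonded (length A) (type_graph (Type_A 1)) (coeff A)"
    by (simp add: bonded_def A_def)
  show ?thesis
  proof (rule no_three_conjugates_by_computation[OF assms _ _ bonded _ inv, of "[([1], 2)]"])
  qed (unfold A_def B_def, code_simp+)
qed

section \<open>The classical families\<close>

lemma path_graph_iff:
  "i < j \<Longrightarrow> ({i, j}, k) \<in> path_graph n \<longleftrightarrow> 1 \<le> i \<and> i < n \<and> j = i + 1 \<and> k = 3"
  by (auto simp: path_graph_def doubleton_eq_iff)

text \<open>The pairings of \<open>e_k\<close> with the coroots
  \<open>e_l - e_(l+1)\<close>.\<close>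

definition step_config :: "nat \<Rightarrow> nat \<Rightarrow> int" where
  "step_config k l = (if l = k then 1 else if l + 1 = k then - 1 else 0)"

lemma three_conjugates_A:
  assumes C: "finite_coxeter_group C n s m" "has_type n m (Type_A r)" and r: "2 \<le> r"
  shows "\<exists>P. parabolic_subgroup C n s P \<and> P \<noteq> carrier C \<and> product_of_three_conjugates C P"
proof -
  \<comment> \<open>These are the coefficients of an infinite path; only the nodes up to
    \<open>r\<close> are ever fired, so \<open>up\<close> and \<open>down\<close> need no boundary
    cases.\<close>
  define a where "a i l = (if l = i + 1 \<or> i = l + 1 then 1 else 0 :: int)" for i l :: nat
  have up: "fire a k (step_config k) = step_config (k + 1)" for k
    by (auto simp: fire_def step_config_def a_def fun_eq_iff)
  have down: "fire a k (step_config (k + 1)) = step_config k" for k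
    using fire_fire[of a k "step_config k"] by (simp add: up)
  have stay: "fire a i (step_config k) = step_config k" if "i \<noteq> k" "i + 1 \<noteq> k" for i k
    using that by (intro fire_zero) (simp add: step_config_def)
  show ?thesis
  proof (rule three_conjugates_criterion[OF C, of a 1 "step_config 1" "[1]" "step_config ` {1..r + 1}"])
    show "bonded (type_rank (Type_A r)) (type_graph (Type_A r)) a"
      by (auto simp: bonded_def path_graph_iff a_def bond_def)
    show "1 \<in> {1..type_rank (Type_A r)}" "set [1] \<subseteq> {1..type_rank (Type_A r)}" using r by auto
    show "0 < step_config 1 1" by (simp add: step_config_def)
    show "step_config 1 i = 0" if "i \<in> {1..type_rank (Type_A r)} - {1}" for i
      using that by (auto simp: step_config_def)
    show "step_config 1 \<in> step_config ` {1..r + 1}" by simp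
    show "fire a i z \<in> step_config ` {1..r + 1}"
      if z: "z \<in> step_config ` {1..r + 1}" and i: "i \<in> {1..type_rank (Type_A r)}" "0 < z i" for z i
    proof -
      obtain k where k: "k \<in> {1..r + 1}" "z = step_config k" using z by blast
      then have "k = i" using i(2) by (auto simp: step_config_def split: if_splits)
      then have "fire a i z = step_config (i + 1)" using up k(2) by simp
      moreover have "i + 1 \<in> {1..r + 1}" using i by simp
      ultimately show ?thesis by blast
    qed
    show "reached a ({1..type_rank (Type_A r)} - {1}) (step_config 1) [1] z"
      if z: "z \<in> step_config ` {1..r + 1}"
        and dom: "\<And>i. i \<in> {1..type_rank (Type_A r)} - {1} \<Longrightarrow> 0 \<le> z i" for z
    proof -
      obtain k where k: "k \<in> {1..r + 1}" "z = step_config k" using z by blast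
      have "k \<le> 2"
      proof (rule ccontr)
        assume "\<not> k \<le> 2"
        then have "k - 1 \<in> {1..type_rank (Type_A r)} - {1}" using k(1) by auto
        from dom[OF this] show False using \<open>\<not> k \<le> 2\<close> k(2)
          by (auto simp: step_config_def split: if_splits)
      qed
      then consider "k = 1" | "k = 2" using k(1) by fastforce
      then show ?thesis
      proof cases
        case 1
        then have "z = fires a ([] @ [1] @ [] @ rev [1]) (step_config 1)" using k(2) by simp
        then show ?thesis unfolding reached_def by (intro exI[of _ "[]"]) simp
      next
        case 2
        \<comment> \<open>The common neighbour of \<open>e_1\<close> and \<open>e_2\<close> is
          \<open>e_3\<close>, which is in the orbit because \<open>r \<ge> 2\<close>.\<close>
        have "fires a ([2] @ [1] @ [2] @ rev [1]) (step_config 1) = step_config 2"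
          using up[of 1] up[of 2] down[of 2] stay[of 1 3] by (simp add: numeral_eq_Suc)
        then have "z = fires a ([2] @ [1] @ [2] @ rev [1]) (step_config 1)" using k(2) 2 by simp
        then show ?thesis using r unfolding reached_def by (intro exI[of _ "[2]"]) simp
      qed
    qed
  qed
qed

lemma fire_uminus: "fire a i (\<lambda>l. - c l) = (\<lambda>l. - fire a i c l)"
  by (auto simp: fire_def fun_eq_iff)

text \<open>
  In types \<open>B\<close> and \<open>D\<close> the orbit consists of the vectors \<open>\<plusminus>e\<^sub>k\<close>, where \<open>V k\<close> is the configuration
  of \<open>e\<^sub>k\<close>.
\<close>

lemma three_conjugates_signed:
  fixes V :: "nat \<Rightarrow> nat \<Rightarrow> int"
  assumes C: "finite_coxeter_group C n s m" "has_type n m T" and T: "type_rank T = r" "3 \<le> r"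
    and a: "bonded r (type_graph T) a"
    and up: "\<And>k. k \<in> {1..<r} \<Longrightarrow> fire a k (V k) = V (k + 1)"
    and closed: "\<And>i k. i \<in> {1..r} \<Longrightarrow> k \<in> {1..r} \<Longrightarrow>
      fire a i (V k) \<in> V ` {1..r} \<union> (\<lambda>k l. - V k l) ` {1..r}"
    and V1: "V 1 1 = 1" "\<And>i. i \<in> {1..r} - {1} \<Longrightarrow> V 1 i = 0" and V3: "V 3 1 = 0"
    and neg: "\<And>k. k \<in> {3..r} \<Longrightarrow> V k (k - 1) < 0" and pos: "\<And>k. k \<in> {2..r} \<Longrightarrow> 0 < V k k"
    and flip: "set f \<subseteq> {1..r} - {1}" "fires a f (V r) = (\<lambda>l. - V r l)"
  shows "\<exists>P. parabolic_subgroup C n s P \<and> P \<noteq> carrier C \<and> product_of_three_conjugates C P"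
proof -
  define I where "I = {1..r} - {1}"
  define S where "S = V ` {1..r} \<union> (\<lambda>k l. - V k l) ` {1..r}"
  have down: "fire a k (V (k + 1)) = V k" if "k \<in> {1..<r}" for k
    using fire_fire[of a k "V k"] up[OF that] by simp
  \<comment> \<open>Downward induction from \<open>r\<close>: \<open>V k\<close> is carried to
    \<open>V (k + 1)\<close>, negated there and carried back.\<close>
  have "\<exists>q. set q \<subseteq> I \<and> fires a q (V k) = (\<lambda>l. - V k l)" if "2 \<le> k" "k \<le> r" for k
    using that(2,1)
  proof (induction k rule: inc_induct)
    case base
    then show ?case using flip unfolding I_def by blast
  next
    case (step k)
    then have k: "k \<in> {1..<r}" "k \<in> I" by (auto simp: I_def)
    obtain q where q: "set q \<subseteq> I" "fires a q (V (k + 1)) = (\<lambda>l. - V (k + 1) l)"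
      using step by auto
    then have "fires a (k # q @ [k]) (V k) = (\<lambda>l. - V k l)"
      using up[OF k(1)] down[OF k(1)] by (simp add: fire_uminus)
    moreover have "set (k # q @ [k]) \<subseteq> I" using q k by simp
    ultimately show ?case by blast
  qed
  then obtain q where q: "set q \<subseteq> I" "fires a q (V 2) = (\<lambda>l. - V 2 l)" using T(2) by force
  have up12: "fire a 1 (V 1) = V 2" "fire a 2 (V 2) = V 3" "fire a 1 (V 2) = V 1" "fire a 2 (V 3) = V 2"
    using up[of 1] up[of 2] down[of 1] down[of 2] T(2) by (simp_all add: numeral_eq_Suc)
  show ?thesis
  proof (rule three_conjugates_criterion[OF C, of a 1 "V 1" "[1]" S])
    show "bonded (type_rank T) (type_graph T) a" using a T by simp
    show "1 \<in> {1..type_rank T}" "set [1] \<subseteq> {1..type_rank T}" "0 < V 1 1" using T V1 by auto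
    show "V 1 i = 0" if "i \<in> {1..type_rank T} - {1}" for i using that V1(2) T by simp
    show "V 1 \<in> S" using T by (auto simp: S_def)
    show "fire a i z \<in> S" if z: "z \<in> S" and i: "i \<in> {1..type_rank T}" "0 < z i" for z i
    proof -
      from z consider k where "k \<in> {1..r}" "z = V k" | k where "k \<in> {1..r}" "z = (\<lambda>l. - V k l)"
        unfolding S_def by blast
      then show ?thesis
      proof cases
        case 1
        then show ?thesis using closed i T unfolding S_def by simp
      next
        case (2 k)
        then have "fire a i (V k) \<in> S" using closed i T unfolding S_def by simp
        then show ?thesis unfolding 2 fire_uminus S_def by force
      qed
    qed
    show "reached a ({1..type_rank T} - {1}) (V 1) [1] z"
      if z: "z \<in> S" and dom: "\<And>i. i \<in> {1..type_rank T} - {1} \<Longrightarrow> 0 \<le> z i" for z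
    proof -
      have "z \<in> {V 1, V 2, \<lambda>l. - V 1 l}"
      proof -
        from z consider k where "k \<in> {1..r}" "z = V k" | k where "k \<in> {1..r}" "z = (\<lambda>l. - V k l)"
          unfolding S_def by blast
        then show ?thesis
        proof cases
          case (1 k)
          have "\<not> 3 \<le> k"
          proof
            assume "3 \<le> k"
            then have "k - 1 \<in> {1..type_rank T} - {1}" "V k (k - 1) < 0" using 1 T neg[of k] by auto
            then show False using dom[of "k - 1"] 1 by simp
          qed
          then have "k = 1 \<or> k = 2" using 1 by auto
          then show ?thesis using 1 by blast
        next
          case (2 k)
          have "\<not> 2 \<le> k"
          proof
            assume "2 \<le> k"
            then have "k \<in> {1..type_rank T} - {1}" "0 < V k k" using 2 T pos[of k] by auto
            then show False using dom[of k] 2 by simp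
          qed
          then have "k = 1" using 2 by auto
          then show ?thesis using 2 by blast
        qed
      qed
      then consider "z = V 1" | "z = V 2" | "z = (\<lambda>l. - V 1 l)" by blast
      then show ?thesis
      proof cases
        case 1
        then have "z = fires a ([] @ [1] @ [] @ rev [1]) (V 1)" by simp
        then show ?thesis unfolding reached_def by (intro exI[of _ "[]"]) simp
      next
        case 2
        have "fire a 1 (V 3) = V 3" using V3 by (rule fire_zero)
        then have "z = fires a ([2] @ [1] @ [2] @ rev [1]) (V 1)" using 2 up12 by simp
        then show ?thesis using T unfolding reached_def by (intro exI[of _ "[2]"]) simp
      next
        case 3
        \<comment> \<open>The common neighbour of \<open>e_1\<close> and \<open>- e_1\<close> is
          \<open>e_2\<close>, which \<open>q\<close> negates.\<close>
        then have "z = fires a ([] @ [1] @ q @ rev [1]) (V 1)"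
          using q(2) up12 by (simp add: fire_uminus)
        then show ?thesis using q(1) T unfolding reached_def I_def
          by (intro exI[of _ "[]"] exI[of _ q]) simp
      qed
    qed
  qed
qed

lemma three_conjugates_B:
  assumes C: "finite_coxeter_group C n s m" "has_type n m (Type_B r)" and r: "3 \<le> r"
  shows "\<exists>P. parabolic_subgroup C n s P \<and> P \<noteq> carrier C \<and> product_of_three_conjugates C P"
proof -
  define a where "a i l = (if i = r then (if l + 1 = r then 1 else 0) else if i = l + 1 then 1
    else if l = i + 1 then (if l = r then 2 else 1) else 0 :: int)" for i l
  \<comment> \<open>The last simple root is the short root \<open>e_r\<close>; its coroot is
    \<open>2 e_r\<close>, whence the value 2.\<close>
  define V where "V k l = (if l = r then (if k = r then 2 else 0) else step_config k l)" for k l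
  have up: "fire a k (V k) = V (k + 1)" if "k \<in> {1..<r}" for k
    using that by (auto simp: fire_def V_def step_config_def a_def fun_eq_iff)
  have flip: "fire a r (V r) = (\<lambda>l. - V r l)"
    using r by (auto simp: fire_def V_def step_config_def a_def fun_eq_iff)
  show ?thesis
  proof (rule three_conjugates_signed[OF C _ r, of a V "[r]"])
    show "bonded r (type_graph (Type_B r)) a"
      using r by (auto simp: bonded_def path_graph_iff a_def bond_def doubleton_eq_iff)
    show "fire a i (V k) \<in> V ` {1..r} \<union> (\<lambda>k l. - V k l) ` {1..r}"
      if ik: "i \<in> {1..r}" "k \<in> {1..r}" for i k
    proof -
      consider "k = i" "i < r" | "k = i" "i = r" | "k = i + 1" "i < r" | "V k i = 0"
        using ik by (cases "i = r"; cases "k = i"; cases "k = i + 1"; cases "k = r - 1")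
          (auto simp: V_def step_config_def)
      then show ?thesis
      proof cases
        case 1
        then show ?thesis using up[of k] ik by simp
      next
        case 2
        then show ?thesis using flip ik by blast
      next
        case 3
        then have "fire a i (V k) = V i" using up[of i, symmetric] ik by simp
        then show ?thesis using ik by blast
      next
        case 4
        then have "fire a i (V k) = V k" by (rule fire_zero)
        then show ?thesis using ik by simp
      qed
    qed
    show "fire a k (V k) = V (k + 1)" if "k \<in> {1..<r}" for k using up that .
    show "fires a [r] (V r) = (\<lambda>l. - V r l)" using flip by simp
  qed (use r in \<open>auto simp: V_def step_config_def\<close>)
qed

lemma three_conjugates_D:
  assumes C: "finite_coxeter_group C n s m" "has_type n m (Type_D r)" and r: "4 \<le> r"
  shows "\<exists>P. parabolic_subgroup C n s P \<and> P \<noteq> carrier C \<and> product_of_three_conjugates C P"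
proof -
  define a where "a i l = (if i = r then (if l + 2 = r then 1 else 0)
    else if l = r then (if i + 2 = r then 1 else 0)
    else if l = i + 1 \<or> i = l + 1 then 1 else 0 :: int)" for i l
  \<comment> \<open>The coroot of node \<open>r\<close> is \<open>e_(r-1) + e_r\<close>, which pairs
    to 1 with exactly these two vectors.\<close>
  define V where "V k l = (if l = r then (if k = r \<or> k + 1 = r then 1 else 0) else step_config k l)" for k l
  have up: "fire a k (V k) = V (k + 1)" if "k \<in> {1..<r}" for k
    using that by (auto simp: fire_def V_def step_config_def a_def fun_eq_iff)
  have flip: "fire a r (V r) = (\<lambda>l. - V (r - 1) l)" "fire a r (V (r - 1)) = (\<lambda>l. - V r l)"
    using r by (auto simp: fire_def V_def step_config_def a_def fun_eq_iff)
  show ?thesis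
  proof (rule three_conjugates_signed[OF C, of r a V "[r - 1, r]"])
    show "bonded r (type_graph (Type_D r)) a"
      using r by (auto simp: bonded_def path_graph_iff a_def bond_def doubleton_eq_iff)
    show "fire a i (V k) \<in> V ` {1..r} \<union> (\<lambda>k l. - V k l) ` {1..r}"
      if ik: "i \<in> {1..r}" "k \<in> {1..r}" for i k
    proof -
      consider "k = i" "i < r" | "k = r" "i = r" | "k = r - 1" "i = r" | "k = i + 1" "i < r" | "V k i = 0"
        using ik by (cases "i = r"; cases "k = i"; cases "k = i + 1"; cases "k = r - 1")
          (auto simp: V_def step_config_def)
      then show ?thesis
      proof cases
        case 1
        then show ?thesis using up[of k] ik by simp
      next
        case 2
        then have "fire a i (V k) = (\<lambda>k l. - V k l) (r - 1)" "r - 1 \<in> {1..r}" using flip r by auto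
        then show ?thesis by blast
      next
        case 3
        then have "fire a i (V k) = (\<lambda>k l. - V k l) r" "r \<in> {1..r}" using flip r by auto
        then show ?thesis by blast
      next
        case 4
        then have "fire a i (V k) = V i" using up[of i, symmetric] ik by simp
        then show ?thesis using ik by blast
      next
        case 5
        then have "fire a i (V k) = V k" by (rule fire_zero)
        then show ?thesis using ik by simp
      qed
    qed
    show "fire a k (V k) = V (k + 1)" if "k \<in> {1..<r}" for k using up that .
    show "fires a [r - 1, r] (V r) = (\<lambda>l. - V r l)"
      using flip(1) up[of "r - 1"] r by (simp add: fire_uminus)
  qed (use r in \<open>auto simp: V_def step_config_def\<close>)
qed

section \<open>Dihedral groups\<close>

text \<open>
  The dihedral group acts on the complex plane; the orbit of \<open>1\<close> would have at most three points
  if the group were the product of three conjugates of a subgroup generated by a reflection that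
  fixes \<open>1\<close>.
\<close>

lemma no_three_conjugates_I2:
  assumes C: "finite_coxeter_group C n s m" and T: "has_type n m (Type_I2 k)" and k: "4 < k"
  shows "\<not> (\<exists>P. parabolic_subgroup C n s P \<and> P \<noteq> carrier C \<and> product_of_three_conjugates C P)"
proof
  assume "\<exists>P. parabolic_subgroup C n s P \<and> P \<noteq> carrier C \<and> product_of_three_conjugates C P"
  then obtain P I where P: "conjugate_in C (generate C (s ` I)) P" "I \<subseteq> {1..n}" "P \<noteq> carrier C"
    "product_of_three_conjugates C P"
    by (auto simp: parabolic_subgroup_def)
  have cm: "coxeter_matrix n m" and pres: "has_presentation C {1..n} s (coxeter_relators n m)"
    using C by (simp_all add: finite_coxeter_group_def)
  then interpret group C by (simp add: has_presentation_def)
  have gens: "s ` {1..n} \<subseteq> carrier C" "generate C (s ` {1..n}) = carrier C"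
    using pres by (simp_all only: has_presentation_def)
  obtain j x where j: "j \<in> {1..n}" "x \<in> carrier C" and cover: "\<And>g. g \<in> carrier C \<Longrightarrow>
      \<exists>p\<in>generate C (s ` ({1..n} - {j})). \<exists>q\<in>generate C (s ` ({1..n} - {j})).
      \<exists>h\<in>generate C (s ` ({1..n} - {j})). g = p \<otimes>\<^bsub>C\<^esub> x \<otimes>\<^bsub>C\<^esub> q \<otimes>\<^bsub>C\<^esub> inv\<^bsub>C\<^esub> x \<otimes>\<^bsub>C\<^esub> h"
    using three_conjugates_double_coset[OF gens P(2,1,3,4)] by (elim bexE) (rule that, auto)
  obtain q where q: "bij_betw q {1..type_rank (Type_I2 k)} {1..n}"
    and edge: "\<And>i j l. i \<in> {1..type_rank (Type_I2 k)} \<Longrightarrow> j \<in> {1..type_rank (Type_I2 k)} \<Longrightarrow> i \<noteq> j \<Longrightarrow>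
      ({i, j}, l) \<in> type_graph (Type_I2 k) \<longleftrightarrow> 3 \<le> l \<and> m (q i) (q j) = l"
    by (rule has_type_relabel[OF cm T]) (rule that)
  have "{1..type_rank (Type_I2 k)} = {1, 2}" by auto
  then have n: "{1..n} = {q 1, q 2}" "q 1 \<noteq> q 2" using q by (auto simp: bij_betw_def)
  have "m (q 1) (q 2) = k" using edge[of 1 2 k] k by simp
  then have mk: "m u v = k" if "u \<in> {1..n}" "v \<in> {1..n}" "u \<noteq> v" for u v
  proof -
    have "m u v = m v u" using cm that(1,2) unfolding coxeter_matrix_def by blast
    moreover have "u = q 1 \<and> v = q 2 \<or> u = q 2 \<and> v = q 1" using that unfolding n(1) by blast
    ultimately show ?thesis using \<open>m (q 1) (q 2) = k\<close> by auto
  qed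
  define i where "i = (if j = q 1 then q 2 else q 1)"
  have i: "{1..n} = {i, j}" "i \<noteq> j" "{1..n} - {j} = {i}" using n j(1) by (auto simp: i_def)
  \<comment> \<open>The generator \<open>s i\<close> kept in the parabolic acts as conjugation, the
    other as \<open>z \<mapsto> \<zeta> * cnj z\<close>; their products are rotations by the angle
    \<open>\<theta>\<close> in either direction, so the relators act trivially.\<close>
  define \<theta> where "\<theta> = 2 * pi / real k"
  define \<zeta> where "\<zeta> = cis \<theta>"
  have \<zeta>: "\<zeta> ^ k = 1" "cnj \<zeta> * \<zeta> = 1" "\<zeta> * cnj \<zeta> = 1"
    using k by (simp_all add: \<zeta>_def \<theta>_def DeMoivre cis_cnj cis_mult)
  have cnj_\<zeta>: "cnj \<zeta> ^ k = 1" using \<zeta>(1) by (simp flip: complex_cnj_power)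
  define \<tau> where "\<tau> u z = (if u = i then cnj z else \<zeta> * cnj z)" for u z
  have \<tau>_i: "\<tau> i = cnj" and \<tau>_j: "\<tau> j = (\<lambda>z. \<zeta> * cnj z)" using i(2) by (auto simp: \<tau>_def)
  have sq: "\<tau> u \<circ> \<tau> u = id" for u
    using \<zeta> by (auto simp: \<tau>_def fun_eq_iff mult.assoc[symmetric])
  have pow: "(\<lambda>z. w * z) ^^ l = (\<lambda>z. w ^ l * z)" for w :: complex and l
    by (induction l) (auto simp: fun_eq_iff mult.assoc)
  have rels: "word_act \<tau> r = id" if rel: "r \<in> coxeter_relators n m" for r
  proof -
    obtain u v where uv: "u \<in> {1..n}" "v \<in> {1..n}"
      and r: "r = concat (replicate (m u v) [(u, True), (v, True)])"
      using rel unfolding coxeter_relators_def by blast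
    have "(\<tau> u \<circ> \<tau> v) ^^ m u v = id"
    proof (cases "u = v")
      case True
      then have "m u v = 1" using cm uv by (auto simp: coxeter_matrix_def)
      then show ?thesis using True sq by simp
    next
      case False
      then have "m u v = k" using mk uv by simp
      moreover have "\<tau> u \<circ> \<tau> v = (\<lambda>z. cnj \<zeta> * z) \<or> \<tau> u \<circ> \<tau> v = (\<lambda>z. \<zeta> * z)"
      proof -
        have "u = i \<and> v = j \<or> u = j \<and> v = i" using False uv unfolding i(1) by blast
        then show ?thesis by (elim disjE) (simp_all add: \<tau>_i \<tau>_j fun_eq_iff)
      qed
      ultimately show ?thesis using \<zeta>(1) cnj_\<zeta> by (elim disjE) (simp_all only: pow mult_1_left id_def)
    qed
    then show ?thesis by (simp add: r word_act_replicate)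
  qed
  obtain \<rho> where \<rho>: "\<And>u. u \<in> {1..n} \<Longrightarrow> \<rho> (s u) = \<tau> u"
    "\<And>g h. g \<in> carrier C \<Longrightarrow> h \<in> carrier C \<Longrightarrow> \<rho> (g \<otimes>\<^bsub>C\<^esub> h) = \<rho> g \<circ> \<rho> h"
    by (rule presentation_action[OF pres, of \<tau>]) (rule sq, erule rels, rule that)
  have ij: "i \<in> {1..n}" "j \<in> {1..n}" unfolding i(1) by simp_all
  then have sc: "s i \<in> carrier C" "s j \<in> carrier C" using gens(1) by blast+
  have \<rho>s: "\<rho> (s i) = cnj" "\<rho> (s j) = (\<lambda>z. \<zeta> * cnj z)" using \<rho>(1)[OF ij(1)] \<rho>(1)[OF ij(2)] \<tau>_i \<tau>_j by simp_all
  have "s i \<otimes>\<^bsub>C\<^esub> s i = \<one>\<^bsub>C\<^esub>"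
  proof -
    have "m i i = 1" using cm ij(1) unfolding coxeter_matrix_def by blast
    then show ?thesis using coxeter_relation[OF C ij(1) ij(1)] sc by simp
  qed
  then have inv: "inv\<^bsub>C\<^esub> s i = s i" using sc(1) by (simp add: inv_equality)
  have one: "\<rho> \<one>\<^bsub>C\<^esub> = id"
  proof -
    have "\<rho> (s i \<otimes>\<^bsub>C\<^esub> s i) = cnj \<circ> cnj" using \<rho>(2)[OF sc(1) sc(1)] \<rho>s by simp
    then show ?thesis using \<open>s i \<otimes>\<^bsub>C\<^esub> s i = \<one>\<^bsub>C\<^esub>\<close> by (simp add: fun_eq_iff)
  qed
  have W: "g \<in> carrier C \<and> (\<rho> g = id \<or> \<rho> g = cnj)" if "g \<in> generate C (s ` ({1..n} - {j}))" for g
    using that unfolding i(3)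
    by (induction rule: generate.induct) (auto simp: one sc \<rho>s inv \<rho>(2) fun_eq_iff)
  \<comment> \<open>\<open>q\<close> acts as the identity or as conjugation, so
    \<open>x q x^-1\<close> sends 1 to 1 or to \<open>w\<close>; then \<open>p\<close> can only
    conjugate.\<close>
  define w where "w = \<rho> x (cnj (\<rho> (inv\<^bsub>C\<^esub> x) 1))"
  have few: "\<rho> g 1 \<in> {1, w, cnj w}" if g: "g \<in> carrier C" for g
  proof -
    obtain p q h where pqh: "p \<in> generate C (s ` ({1..n} - {j}))" "q \<in> generate C (s ` ({1..n} - {j}))"
      "h \<in> generate C (s ` ({1..n} - {j}))" "g = p \<otimes>\<^bsub>C\<^esub> x \<otimes>\<^bsub>C\<^esub> q \<otimes>\<^bsub>C\<^esub> inv\<^bsub>C\<^esub> x \<otimes>\<^bsub>C\<^esub> h"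
      using cover[OF g] by blast
    then have W': "p \<in> carrier C" "q \<in> carrier C" "h \<in> carrier C" "\<rho> p = id \<or> \<rho> p = cnj"
      "\<rho> q = id \<or> \<rho> q = cnj" "\<rho> h 1 = 1"
      using W[of p] W[of q] W[of h] by auto
    have "\<rho> x (\<rho> (inv\<^bsub>C\<^esub> x) 1) = (\<rho> (x \<otimes>\<^bsub>C\<^esub> inv\<^bsub>C\<^esub> x)) 1" using \<rho>(2)[of x "inv\<^bsub>C\<^esub> x"] j(2) by simp
    then have xx: "\<rho> x (\<rho> (inv\<^bsub>C\<^esub> x) 1) = 1" using j(2) one by simp
    have "\<rho> g 1 = \<rho> p (\<rho> x (\<rho> q (\<rho> (inv\<^bsub>C\<^esub> x) 1)))" using W' j(2) by (simp add: pqh(4) \<rho>(2))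
    then show ?thesis using W'(4,5) xx by (auto simp: w_def)
  qed
  \<comment> \<open>Three distinct points other than 1 do not fit into \<open>{w, cnj w}\<close>. As
    \<open>k > 4\<close>, both \<open>\<zeta>\<close> and its square lie in the open upper half
    plane, away from 1 and \<open>cnj \<zeta>\<close>.\<close>
  have "\<rho> (s j) 1 = \<zeta>" "\<rho> (s i \<otimes>\<^bsub>C\<^esub> s j) 1 = cnj \<zeta>" "\<rho> (s j \<otimes>\<^bsub>C\<^esub> (s i \<otimes>\<^bsub>C\<^esub> s j)) 1 = \<zeta> * \<zeta>"
    using sc by (simp_all add: \<rho>(2) \<rho>s)
  then have mem: "\<zeta> \<in> {1, w, cnj w}" "cnj \<zeta> \<in> {1, w, cnj w}" "\<zeta> * \<zeta> \<in> {1, w, cnj w}"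
    using few[of "s j"] few[of "s i \<otimes>\<^bsub>C\<^esub> s j"] few[of "s j \<otimes>\<^bsub>C\<^esub> (s i \<otimes>\<^bsub>C\<^esub> s j)"] sc by simp_all
  have \<theta>: "0 < \<theta>" "2 * \<theta> < pi" using k by (simp_all add: \<theta>_def field_simps)
  then have im: "0 < Im \<zeta>" "0 < Im (\<zeta> * \<zeta>)"
    by (auto simp: \<zeta>_def cis_mult intro!: sin_gt_zero)
  then have ne: "\<zeta> \<noteq> 1" "cnj \<zeta> \<noteq> 1" "\<zeta> \<noteq> cnj \<zeta>" "\<zeta> * \<zeta> \<noteq> 1" "\<zeta> * \<zeta> \<noteq> cnj \<zeta>"
    by (auto simp: complex_eq_iff)
  have "\<zeta> * \<zeta> \<noteq> \<zeta>" using ne(1) by (simp add: \<zeta>_def cis_neq_zero)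
  then show False using mem ne by auto
qed

theorem theorem4:
  fixes C :: "('a, 'b) monoid_scheme"
    and n :: nat and s :: "nat \<Rightarrow> 'a" and m :: "nat \<Rightarrow> nat \<Rightarrow> nat"
  assumes "finite_coxeter_group C n s m"
    and "irreducible_coxeter n m"
  shows "(\<forall>T \<in> {Type_A k | k. 2 \<le> k} \<union> {Type_B k | k. 3 \<le> k} \<union> {Type_D k | k. 4 \<le> k} \<union>
               {Type_H4, Type_E 6, Type_E 7, Type_E 8}.
            has_type n m T \<longrightarrow>
              (\<exists>P. parabolic_subgroup C n s P \<and> P \<noteq> carrier C \<and> product_of_three_conjugates C P))
       \<and> (\<forall>T \<in> {Type_A 1, Type_B 2, Type_F4, Type_H3} \<union> {Type_I2 k | k. 4 < k}.
            has_type n m T \<longrightarrow>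
              \<not> (\<exists>P. parabolic_subgroup C n s P \<and> P \<noteq> carrier C \<and> product_of_three_conjugates C P))"
proof (intro conjI ballI impI)
  fix T
  assume "T \<in> {Type_A k | k. 2 \<le> k} \<union> {Type_B k | k. 3 \<le> k} \<union> {Type_D k | k. 4 \<le> k} \<union>
    {Type_H4, Type_E 6, Type_E 7, Type_E 8}" and T: "has_type n m T"
  then consider k where "T = Type_A k" "2 \<le> k" | k where "T = Type_B k" "3 \<le> k"
    | k where "T = Type_D k" "4 \<le> k" | "T = Type_H4" | "T = Type_E 6" | "T = Type_E 7" | "T = Type_E 8"
    by blast
  then show "\<exists>P. parabolic_subgroup C n s P \<and> P \<noteq> carrier C \<and> product_of_three_conjugates C P"
    using T three_conjugates_A[OF assms(1)] three_conjugates_B[OF assms(1)]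
      three_conjugates_D[OF assms(1)] three_conjugates_H4[OF assms(1)] three_conjugates_E6[OF assms(1)]
      three_conjugates_E7[OF assms(1)] three_conjugates_E8[OF assms(1)]
    by cases simp_all
next
  fix T
  assume "T \<in> {Type_A 1, Type_B 2, Type_F4, Type_H3} \<union> {Type_I2 k | k. 4 < k}" and T: "has_type n m T"
  then consider "T = Type_A 1" | "T = Type_B 2" | "T = Type_F4" | "T = Type_H3"
    | k where "T = Type_I2 k" "4 < k"
    by blast
  then show "\<not> (\<exists>P. parabolic_subgroup C n s P \<and> P \<noteq> carrier C \<and> product_of_three_conjugates C P)"
    using T no_three_conjugates_A1[OF assms(1)] no_three_conjugates_B2[OF assms(1)]
      no_three_conjugates_F4[OF assms(1)] no_three_conjugates_H3[OF assms(1)]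
      no_three_conjugates_I2[OF assms(1)]
    by cases simp_all
qed

end
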